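(* Let $p\ge1$ and let $L$ be the linear matrix differential operator of order $p$ \[L=D^p\cdot-A_{p-1}(t)D^{p-1}\cdot-\cdots-A_1(t)D\cdot-A_0(t)\cdot,\] where $D=d/dt$ and each $A_j(t)$, $j=0,\ldots,p-1$, is a real $n\times n$ matrix function that is $C^p$-smooth on $[a,b]$. Let its adjoint be \[L^*=(-1)^pD^p\cdot+(-1)^pD^{p-1}(A_{p-1}(t)'\cdot)+(-1)^{p-1}D^{p-2}(A_{p-2}(t)'\cdot)+\cdots+D(A_1(t)'\cdot)-A_0(t)'\cdot\] (the general term being $(-1)^{j+1}D^j(A_j(t)'\cdot)$). Let $\Delta: a=t_0<t_1<\cdots<t_m=b$ be a partition of $[a,b]$ and let $\Omega$ be the set of all functions $g:[a,b]\to\mathbb{R}^n$ that are of class $C^{2p-2}$ on $[a,b]$ and of class $C^{2p}$ on each interval $[t_i,t_{i+1}]$, $i=0,\ldots,m-1$. Call $s:[a,b]\to\mathbb{R}^n$ a generalized spline in $\mathbb{R}^n$ (associated to $L$ and $\Delta$) with interpolation data $s_0,\ldots,s_m\in\mathbb{R}^n$ and boundary data $\eta_0^k,\eta_m^k\in\mathbb{R}^n$ ($k=1,\ldots,p-1$) if $s\in\Omega$, $s$ solves $L^*Ls=0$ on each interval $[t_i,t_{i+1}]$, $s(t_i)=s_i$ for $i=0,\ldots,m$, and $s^{(k)}(t_0)=\eta_0^k$, $s^{(k)}(t_m)=\eta_m^k$ for $k=1,\ldots,p-1$. Then for each choice of such interpolation and boundary data there exists a unique generalized spline in $\mathbb{R}^n$,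 and it is the unique minimizer of \[\int_a^b\langle Lg,Lg\rangle\,dt\] among all functions $g\in\Omega$ satisfying the same interpolation and boundary conditions.
   Context: $\langle\cdot,\cdot\rangle$ denotes the Euclidean inner product on $\mathbb{R}^n$ and a prime ${}'$ denotes matrix transpose. The adjoint $L^*$ is the formal adjoint with respect to the scalar product $\langle x_1,x_2\rangle=\int_a^b x_1(t)'x_2(t)\,dt$. *)

theory Defs
  imports "HOL-Analysis.Analysis"
begin

text \<open>j-th derivative of f taken within the set S (one-sided at endpoints of an interval).\<close>
fun nderiv :: "real set \<Rightarrow> nat \<Rightarrow> (real \<Rightarrow> 'a::real_normed_vector) \<Rightarrow> real \<Rightarrow> 'a" where
  "nderiv S 0 f = f"
| "nderiv S (Suc j) f = (\<lambda>t. vector_derivative (nderiv S j f) (at t within S))"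

definition C_on :: "nat \<Rightarrow> real set \<Rightarrow> (real \<Rightarrow> 'a::real_normed_vector) \<Rightarrow> bool" where
  "C_on k S f \<longleftrightarrow>
     (\<forall>j<k. \<forall>t\<in>S. (nderiv S j f has_vector_derivative nderiv S (Suc j) f t) (at t within S))
     \<and> continuous_on S (nderiv S k f)"

definition Lop :: "nat \<Rightarrow> (nat \<Rightarrow> real \<Rightarrow> real^'n^'n) \<Rightarrow> real set \<Rightarrow> (real \<Rightarrow> real^'n) \<Rightarrow> real \<Rightarrow> real^'n" where
  "Lop p A S g t = nderiv S p g t - (\<Sum>j<p. A j t *v nderiv S j g t)"

definition Ladj :: "nat \<Rightarrow> (nat \<Rightarrow> real \<Rightarrow> real^'n^'n) \<Rightarrow> real set \<Rightarrow> (real \<Rightarrow> real^'n) \<Rightarrow> real \<Rightarrow> real^'n" where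
  "Ladj p A S u t = (-1)^p *\<^sub>R nderiv S p u t
     + (\<Sum>j<p. (-1)^(j+1) *\<^sub>R nderiv S j (\<lambda>\<tau>. transpose (A j \<tau>) *v u \<tau>) t)"

definition Omega :: "nat \<Rightarrow> (nat \<Rightarrow> real) \<Rightarrow> nat \<Rightarrow> (real \<Rightarrow> real^'n) set" where
  "Omega p tt m = {g. C_on (2*p-2) {tt 0..tt m} g \<and>
                      (\<forall>i<m. C_on (2*p) {tt i..tt (Suc i)} g)}"

definition interp_bc :: "nat \<Rightarrow> (nat \<Rightarrow> real) \<Rightarrow> nat \<Rightarrow> (nat \<Rightarrow> real^'n) \<Rightarrow> (nat \<Rightarrow> real^'n)
     \<Rightarrow> (nat \<Rightarrow> real^'n) \<Rightarrow> (real \<Rightarrow> real^'n) \<Rightarrow> bool" where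
  "interp_bc p tt m sd eta0 etam g \<longleftrightarrow>
     (\<forall>i\<le>m. g (tt i) = sd i) \<and>
     (\<forall>k\<in>{1..p-1}. nderiv {tt 0..tt m} k g (tt 0) = eta0 k
                  \<and> nderiv {tt 0..tt m} k g (tt m) = etam k)"

definition gen_spline :: "nat \<Rightarrow> (nat \<Rightarrow> real \<Rightarrow> real^'n^'n) \<Rightarrow> (nat \<Rightarrow> real) \<Rightarrow> nat
     \<Rightarrow> (nat \<Rightarrow> real^'n) \<Rightarrow> (nat \<Rightarrow> real^'n) \<Rightarrow> (nat \<Rightarrow> real^'n) \<Rightarrow> (real \<Rightarrow> real^'n) \<Rightarrow> bool" where
  "gen_spline p A tt m sd eta0 etam s \<longleftrightarrow>
     s \<in> Omega p tt m \<and>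
     (\<forall>i<m. \<forall>t\<in>{tt i..tt (Suc i)}.
        Ladj p A {tt i..tt (Suc i)} (Lop p A {tt i..tt (Suc i)} s) t = 0) \<and>
     interp_bc p tt m sd eta0 etam s"

definition Jfun :: "nat \<Rightarrow> (nat \<Rightarrow> real \<Rightarrow> real^'n^'n) \<Rightarrow> real \<Rightarrow> real \<Rightarrow> (real \<Rightarrow> real^'n) \<Rightarrow> real" where
  "Jfun p A a b g = integral {a..b} (\<lambda>t. Lop p A {a..b} g t \<bullet> Lop p A {a..b} g t)"

end

theory Submission
  imports Defs
begin

text \<open>
  Optimality rests on Lagrange's identity: \<open>\<langle>h, L\<^sup>* u\<rangle> - \<langle>L h, u\<rangle>\<close> is the derivative of the
  bilinear form pairing the derivatives of \<open>h\<close> with the quasi-derivatives of \<open>u\<close>.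
  For a spline \<open>s\<close>, \<open>u = L s\<close> and \<open>h = g - s\<close>, the boundary terms telescope over the partition,
  so \<open>L s\<close> and \<open>L h\<close> are orthogonal and \<open>J g = J s + J h\<close>; moreover \<open>J h = 0\<close> forces \<open>h = 0\<close> by
  uniqueness for linear differential equations. This also gives uniqueness of the spline.

  For existence, \<open>L\<^sup>* L s = 0\<close> is a first-order linear system for the derivatives of \<open>s\<close> and the
  quasi-derivatives of \<open>L s\<close>, and \<open>s \<in> \<Omega>\<close> means that only the lowest quasi-derivative may jump
  at the interior knots. Once the derivatives at \<open>a\<close> are fixed, the initial quasi-derivatives and
  the jumps are as many unknowns as there are remaining data; this square linear system has trivial
  kernel by uniqueness, hence is solvable.
\<close>

section \<open>Iterated one-sided derivatives\<close>

text \<open>The behaviour at interior knots shapes the proof. Quasi-derivative \<open>k\<close> of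
  \<open>L s\<close> involves derivatives of \<open>L s\<close> up to order \<open>p - k\<close>,
  hence derivatives of \<open>s\<close> up to order \<open>2p - k\<close>. Membership in \<Omega>
  gives continuity up to order \<open>2p - 2\<close>, so numbers \<open>2, ..., p\<close> are
  continuous and number \<open>1\<close> is free. Conversely, continuity of those numbers makes
  \<open>L s\<close> of class \<open>C^(p-2)\<close>, and then \<open>s\<close> of class
  \<open>C^(2p-2)\<close>. Derivatives are always taken within a set, and at a knot those within a
  piece and those within the whole interval are known to agree only up to the order of global
  smoothness. For \<open>p = 1\<close> a function in \<Omega> need not even be differentiable at a
  knot; hence \<open>L\<close> is applied piece by piece, and the functional is compared inside the
  pieces only. Strict minimality is proved for any given spline before a spline is known to exist.
  Comparison with the zero function then yields the trivial kernel on which existence rests, so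
  there is no circularity.\<close>

lemma has_vector_derivative_Icc_unique:
  fixes f :: "real \<Rightarrow> 'a::real_normed_vector"
  assumes "c < d" "t \<in> {c..d}" "(f has_vector_derivative f') (at t within {c..d})"
  shows "vector_derivative f (at t within {c..d}) = f'"
  using assms vector_derivative_within_cbox[of c d t f f'] by (simp add: cbox_interval)

text \<open>Both sides choose from the same set of candidate derivatives, so equality holds even
  where no derivative exists. This is why \<open>nderiv_cong\<close> needs no smoothness.\<close>

lemma vector_derivative_cong_on:
  assumes "\<And>x. x \<in> S \<Longrightarrow> f x = g x" "t \<in> S"
  shows "vector_derivative f (at t within S) = vector_derivative g (at t within S)"
proof -
  have "(f has_vector_derivative D) (at t within S) \<longleftrightarrow>
        (g has_vector_derivative D) (at t within S)" for D
    using has_vector_derivative_transform[of t S f g D] has_vector_derivative_transform[of t S g f D]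
      assms by auto
  then show ?thesis unfolding vector_derivative_def by simp
qed

lemma nderiv_cong:
  assumes "\<And>x. x \<in> S \<Longrightarrow> f x = g x" "t \<in> S"
  shows "nderiv S j f t = nderiv S j g t"
  using assms(2)
proof (induction j arbitrary: t)
  case (Suc j)
  show ?case by (simp add: vector_derivative_cong_on[of S "nderiv S j f" "nderiv S j g"] Suc)
qed (simp add: assms)

lemma C_on_cong:
  assumes "\<And>x. x \<in> S \<Longrightarrow> f x = g x" "C_on k S f"
  shows "C_on k S g"
proof -
  have eq: "nderiv S j g t = nderiv S j f t" if "t \<in> S" for j t
    using nderiv_cong[of S g f t j] assms(1) that by auto
  have "(nderiv S j g has_vector_derivative nderiv S (Suc j) g t) (at t within S)"
    if "j < k" "t \<in> S" for j t
    using has_vector_derivative_transform[of t S "nderiv S j g" "nderiv S j f"] assms(2) that eq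
    unfolding C_on_def by metis
  moreover have "continuous_on S (nderiv S k g)"
    using assms(2) eq continuous_on_cong[of S S "nderiv S k f" "nderiv S k g"] unfolding C_on_def by metis
  ultimately show ?thesis unfolding C_on_def by blast
qed

lemma nderiv_nderiv: "nderiv S i (nderiv S j f) = nderiv S (i + j) f"
  by (induction i) auto

lemma C_on_has_vector_derivative:
  "C_on k S f \<Longrightarrow> j < k \<Longrightarrow> t \<in> S \<Longrightarrow>
     (nderiv S j f has_vector_derivative nderiv S (Suc j) f t) (at t within S)"
  unfolding C_on_def by blast

lemma C_on_continuous_nderiv:
  assumes "C_on k S f" "j \<le> k"
  shows "continuous_on S (nderiv S j f)"
proof (cases "j = k")
  case False
  then show ?thesis using assms
    by (intro continuous_on_vector_derivative[of S _ "nderiv S (Suc j) f"] C_on_has_vector_derivative) auto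
qed (use assms in \<open>simp add: C_on_def\<close>)

lemma C_on_mono: "C_on k S f \<Longrightarrow> j \<le> k \<Longrightarrow> C_on j S f"
  using C_on_continuous_nderiv[of k S f j] unfolding C_on_def by auto

lemma C_on_0: "C_on 0 S f \<longleftrightarrow> continuous_on S f"
  by (simp add: C_on_def)

lemma C_on_nderiv:
  assumes "C_on (k + j) S f"
  shows "C_on k S (nderiv S j f)"
  using assms unfolding C_on_def nderiv_nderiv by simp

text \<open>The device for computing iterated derivatives: once a chain of candidates is exhibited,
  uniqueness of derivatives within a nondegenerate interval does the rest. The closure properties
  and the solutions of the differential system go through it.\<close>

lemma nderiv_chain:
  fixes F :: "nat \<Rightarrow> real \<Rightarrow> 'a::real_normed_vector"
  assumes "c < d" and "\<And>t. t \<in> {c..d} \<Longrightarrow> f t = F 0 t"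
    and "\<And>j t. j < k \<Longrightarrow> t \<in> {c..d} \<Longrightarrow> (F j has_vector_derivative F (Suc j) t) (at t within {c..d})"
    and "j \<le> k" "t \<in> {c..d}"
  shows "nderiv {c..d} j f t = F j t"
  using assms(4,5)
proof (induction j arbitrary: t)
  case (Suc j)
  have "nderiv {c..d} (Suc j) f t = vector_derivative (F j) (at t within {c..d})"
    using Suc vector_derivative_cong_on[of "{c..d}" "nderiv {c..d} j f" "F j" t] by simp
  also have "\<dots> = F (Suc j) t"
    using has_vector_derivative_Icc_unique[OF assms(1) Suc.prems(2)] assms(3)[of j t] Suc.prems by simp
  finally show ?case .
qed (use assms in auto)

lemma C_on_chain:
  fixes F :: "nat \<Rightarrow> real \<Rightarrow> 'a::real_normed_vector"
  assumes "c < d" and "\<And>t. t \<in> {c..d} \<Longrightarrow> f t = F 0 t"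
    and F: "\<And>j t. j < k \<Longrightarrow> t \<in> {c..d} \<Longrightarrow> (F j has_vector_derivative F (Suc j) t) (at t within {c..d})"
    and "continuous_on {c..d} (F k)"
  shows "C_on k {c..d} f"
proof -
  note eq = nderiv_chain[where f=f and F=F and k=k, OF assms(1-3)]
  have "(nderiv {c..d} j f has_vector_derivative nderiv {c..d} (Suc j) f t) (at t within {c..d})"
    if "j < k" "t \<in> {c..d}" for j t
    using has_vector_derivative_transform[of t "{c..d}" "nderiv {c..d} j f" "F j"] F eq that
    by (metis Suc_leI less_imp_le)
  moreover have "continuous_on {c..d} (nderiv {c..d} k f)"
    using assms(4) eq continuous_on_cong[of "{c..d}" "{c..d}" "F k" "nderiv {c..d} k f"] by auto
  ultimately show ?thesis unfolding C_on_def by blast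
qed

lemma C_on_SucI:
  fixes f :: "real \<Rightarrow> 'a::real_normed_vector"
  assumes "c < d" and f: "\<And>t. t \<in> {c..d} \<Longrightarrow> (f has_vector_derivative f' t) (at t within {c..d})"
    and f': "C_on k {c..d} f'"
  shows "C_on (Suc k) {c..d} f"
proof (rule C_on_chain[OF assms(1), where F="case_nat f (\<lambda>j. nderiv {c..d} j f')"])
  show "(case_nat f (\<lambda>j. nderiv {c..d} j f') j has_vector_derivative
      case_nat f (\<lambda>j. nderiv {c..d} j f') (Suc j) t) (at t within {c..d})"
    if "j < Suc k" "t \<in> {c..d}" for j t
    using that f C_on_has_vector_derivative[OF f'] by (cases j) (simp_all del: nderiv.simps(2))
qed (use f' in \<open>simp_all add: C_on_def\<close>)

lemma C_on_SucD:
  assumes "C_on (Suc k) S f"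
  shows "\<And>t. t \<in> S \<Longrightarrow> (f has_vector_derivative nderiv S 1 f t) (at t within S)"
    and "C_on k S (nderiv S 1 f)"
  using C_on_has_vector_derivative[OF assms, of 0] C_on_nderiv[of k 1 S f] assms by auto

lemma C_on_subinterval:
  assumes "C_on k {a..b} f" "{c..d} \<subseteq> {a..b}" "c < d"
  shows "C_on k {c..d} f"
    and "\<And>j t. j \<le> k \<Longrightarrow> t \<in> {c..d} \<Longrightarrow> nderiv {c..d} j f t = nderiv {a..b} j f t"
proof -
  have *: "(nderiv {a..b} j f has_vector_derivative nderiv {a..b} (Suc j) f t) (at t within {c..d})"
    if "j < k" "t \<in> {c..d}" for j t
    using C_on_has_vector_derivative[OF assms(1), of j t] that assms(2)
      has_vector_derivative_within_subset by blast
  show "C_on k {c..d} f"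
    using assms * by (intro C_on_chain[where F="\<lambda>j. nderiv {a..b} j f"])
      (auto simp: C_on_def intro: continuous_on_subset simp del: nderiv.simps(2))
  show "\<And>j t. j \<le> k \<Longrightarrow> t \<in> {c..d} \<Longrightarrow> nderiv {c..d} j f t = nderiv {a..b} j f t"
    using assms(3) * by (intro nderiv_chain[where F="\<lambda>j. nderiv {a..b} j f"]) auto
qed

section \<open>Closure of the smoothness classes under sums, linear maps and products\<close>

lemma C_on_add:
  fixes f g :: "real \<Rightarrow> 'a::real_normed_vector"
  assumes "c < d" "C_on k {c..d} f" "C_on k {c..d} g"
  shows "C_on k {c..d} (\<lambda>t. f t + g t)"
    and "\<And>j t. j \<le> k \<Longrightarrow> t \<in> {c..d} \<Longrightarrow>
      nderiv {c..d} j (\<lambda>t. f t + g t) t = nderiv {c..d} j f t + nderiv {c..d} j g t"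
proof -
  let ?F = "\<lambda>j t. nderiv {c..d} j f t + nderiv {c..d} j g t"
  have *: "(?F j has_vector_derivative ?F (Suc j) t) (at t within {c..d})"
    if "j < k" "t \<in> {c..d}" for j t
    using that assms by (intro has_vector_derivative_add C_on_has_vector_derivative)
  show "C_on k {c..d} (\<lambda>t. f t + g t)"
    using assms * by (intro C_on_chain[where F="?F"])
      (auto simp: C_on_def intro: continuous_intros simp del: nderiv.simps(2))
  show "\<And>j t. j \<le> k \<Longrightarrow> t \<in> {c..d} \<Longrightarrow> nderiv {c..d} j (\<lambda>t. f t + g t) t = ?F j t"
    using assms * by (intro nderiv_chain[where F="?F"]) auto
qed

lemma C_on_bounded_linear:
  fixes f :: "real \<Rightarrow> 'a::real_normed_vector"
  assumes "bounded_linear T" "c < d" "C_on k {c..d} f"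
  shows "C_on k {c..d} (\<lambda>t. T (f t))"
    and "\<And>j t. j \<le> k \<Longrightarrow> t \<in> {c..d} \<Longrightarrow>
      nderiv {c..d} j (\<lambda>t. T (f t)) t = T (nderiv {c..d} j f t)"
proof -
  let ?F = "\<lambda>j t. T (nderiv {c..d} j f t)"
  have *: "(?F j has_vector_derivative ?F (Suc j) t) (at t within {c..d})"
    if "j < k" "t \<in> {c..d}" for j t
    using bounded_linear.has_vector_derivative[OF assms(1) C_on_has_vector_derivative[OF assms(3) that]] .
  show "C_on k {c..d} (\<lambda>t. T (f t))"
    using assms * by (intro C_on_chain[where F="?F"])
      (simp_all add: C_on_def bounded_linear.continuous_on del: nderiv.simps(2))
  show "\<And>j t. j \<le> k \<Longrightarrow> t \<in> {c..d} \<Longrightarrow> nderiv {c..d} j (\<lambda>t. T (f t)) t = ?F j t"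
    using assms * by (intro nderiv_chain[where F="?F"]) auto
qed

lemma C_on_const: "c < d \<Longrightarrow> C_on k {c..d} (\<lambda>t. v :: 'a::real_normed_vector)"
  by (rule C_on_chain[where F="\<lambda>j t. if j = 0 then v else 0"]) auto

lemma C_on_sum:
  fixes f :: "'i \<Rightarrow> real \<Rightarrow> 'a::real_normed_vector"
  assumes "c < d" "\<And>i. i \<in> I \<Longrightarrow> C_on k {c..d} (f i)"
  shows "C_on k {c..d} (\<lambda>t. \<Sum>i\<in>I. f i t)"
  using assms(2)
  by (induction I rule: infinite_finite_induct) (auto intro: C_on_const C_on_add assms(1))

lemma C_on_diff:
  fixes f g :: "real \<Rightarrow> 'a::real_normed_vector"
  assumes "c < d" "C_on k {c..d} f" "C_on k {c..d} g"
  shows "C_on k {c..d} (\<lambda>t. f t - g t)"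
    and "\<And>j t. j \<le> k \<Longrightarrow> t \<in> {c..d} \<Longrightarrow>
      nderiv {c..d} j (\<lambda>t. f t - g t) t = nderiv {c..d} j f t - nderiv {c..d} j g t"
proof -
  note m = C_on_bounded_linear[OF bounded_linear_minus[OF bounded_linear_ident] assms(1,3)]
  show "C_on k {c..d} (\<lambda>t. f t - g t)"
    using C_on_add(1)[OF assms(1,2) m(1)] by simp
  show "nderiv {c..d} j (\<lambda>t. f t - g t) t = nderiv {c..d} j f t - nderiv {c..d} j g t"
    if "j \<le> k" "t \<in> {c..d}" for j t
    using C_on_add(2)[OF assms(1,2) m(1) that] m(2)[OF that] by simp
qed

text \<open>Induction with the product rule, both summands of the derivative being again products.
  No Leibniz formula is required, since higher derivatives of products are never expanded.\<close>

lemma C_on_bounded_bilinear: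
  fixes f :: "real \<Rightarrow> 'a::real_normed_vector" and g :: "real \<Rightarrow> 'b::real_normed_vector"
  assumes P: "bounded_bilinear P" and cd: "c < d"
    and "C_on k {c..d} f" "C_on k {c..d} g"
  shows "C_on k {c..d} (\<lambda>t. P (f t) (g t))"
  using assms(3,4)
proof (induction k arbitrary: f g)
  case 0
  then show ?case using bounded_bilinear.continuous_on[OF P] by (simp add: C_on_0)
next
  case (Suc k)
  let ?D = "nderiv {c..d} 1"
  show ?case
  proof (rule C_on_SucI[OF cd, where f'="\<lambda>t. P (f t) (?D g t) + P (?D f t) (g t)"])
    show "((\<lambda>t. P (f t) (g t)) has_vector_derivative P (f t) (?D g t) + P (?D f t) (g t))
      (at t within {c..d})" if "t \<in> {c..d}" for t
      using bounded_bilinear.has_vector_derivative[OF P C_on_SucD(1)[OF Suc.prems(1) that]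
          C_on_SucD(1)[OF Suc.prems(2) that]] .
    show "C_on k {c..d} (\<lambda>t. P (f t) (?D g t) + P (?D f t) (g t))"
      using C_on_SucD(2)[OF Suc.prems(1)] C_on_SucD(2)[OF Suc.prems(2)]
        C_on_mono[OF Suc.prems(1), of k] C_on_mono[OF Suc.prems(2), of k]
      by (intro C_on_add cd Suc.IH) auto
  qed
qed

lemma bounded_bilinear_matrix_vector_mult:
  "bounded_bilinear ((*v) :: real^'n^'m \<Rightarrow> real^'n \<Rightarrow> real^'m)"
  unfolding bilinear_conv_bounded_bilinear[symmetric]
  by (auto simp: bilinear_def linear_iff matrix_vector_mult_add_rdistrib
      matrix_vector_right_distrib scaleR_matrix_vector_assoc[symmetric] matrix_vector_mult_scaleR)

lemma bounded_linear_transpose: "bounded_linear (transpose :: real^'n^'m \<Rightarrow> real^'m^'n)"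
  by (rule linear_conv_bounded_linear[THEN iffD1])
     (auto simp: linear_iff transpose_scalar, auto simp: transpose_def vec_eq_iff)

lemmas C_on_matrix_vector_mult = C_on_bounded_bilinear[OF bounded_bilinear_matrix_vector_mult]
lemmas C_on_transpose = C_on_bounded_linear[OF bounded_linear_transpose]
lemmas C_on_scaleR = C_on_bounded_linear[OF bounded_linear_scaleR_right]
lemmas continuous_on_matrix_vector_mult =
  bounded_bilinear.continuous_on[OF bounded_bilinear_matrix_vector_mult]

text \<open>Near an interior point both restricted filters are the full neighbourhood filter, so no
  smoothness is involved. It covers orders beyond the global smoothness, where
  \<open>C_on_subinterval\<close> does not reach.\<close>

lemma nderiv_interior:
  assumes "{c..d} \<subseteq> {a..b}" "t \<in> {c<..<d}"
  shows "nderiv {a..b} j f t = nderiv {c..d} j f t"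
  using assms(2)
proof (induction j arbitrary: t)
  case (Suc j)
  have "a \<le> c" "d \<le> b" using assms(1) Suc.prems by auto
  then have "a < t" "t < b" using Suc.prems by auto
  then have "at t within {a..b} = at t" "at t within {c..d} = at t"
    using Suc.prems by (auto intro!: at_within_interior)
  moreover have "(nderiv {a..b} j f has_vector_derivative D) (at t) \<longleftrightarrow>
        (nderiv {c..d} j f has_vector_derivative D) (at t)" for D
    using has_vector_derivative_transform_within_open[of _ D t "{c<..<d}"] Suc
    by (metis open_greaterThanLessThan)
  ultimately show ?case by (simp add: vector_derivative_def)
qed simp

section \<open>Differentiability across the knots of a partition\<close>

lemma has_vector_derivative_within_Un:
  assumes "(f has_vector_derivative D) (at t within S)" "(f has_vector_derivative D) (at t within T)"
  shows "(f has_vector_derivative D) (at t within (S \<union> T))"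
  using assms unfolding has_vector_derivative_def has_derivative_within
  by (auto intro: Lim_Un)

lemma partition_strict_mono:
  fixes tt :: "nat \<Rightarrow> real"
  assumes "\<forall>i<m. tt i < tt (Suc i)" "i < j" "j \<le> m"
  shows "tt i < tt j"
  using assms(2,3)
proof (induction j)
  case (Suc j)
  then show ?case using assms(1) by (cases "i = j") (auto intro: less_trans)
qed simp

lemma partition_mono:
  fixes tt :: "nat \<Rightarrow> real"
  assumes "\<forall>i<m. tt i < tt (Suc i)" "i \<le> j" "j \<le> m"
  shows "tt i \<le> tt j"
  using partition_strict_mono[OF assms(1), of i j] assms(2,3) by (cases "i = j") auto

lemma has_vector_derivative_partition:
  fixes f :: "real \<Rightarrow> 'a::real_normed_vector"
  assumes "\<forall>i<m. tt i < tt (Suc i)" "m \<ge> 1"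
    and "\<And>i t. i < m \<Longrightarrow> t \<in> {tt i..tt (Suc i)} \<Longrightarrow>
      (f has_vector_derivative f' t) (at t within {tt i..tt (Suc i)})"
    and "t \<in> {tt 0..tt m}"
  shows "(f has_vector_derivative f' t) (at t within {tt 0..tt m})"
  using assms(2,1,3,4)
proof (induction m arbitrary: t rule: nat_induct_at_least)
  case base
  then show ?case by simp
next
  case (Suc m)
  \<comment> \<open>Off a closed interval the restricted filter is \<open>bot\<close>, so every
    vector is vacuously a derivative; the union rule then applies at all points alike.\<close>
  have outside: "(f has_vector_derivative D) (at t within {c..d})" if "t \<notin> {c..d}" for D c d
  proof -
    have "at t within {c..d} = bot"
      using that closed_atLeastAtMost[of c d] unfolding closed_limpt trivial_limit_within by blast
    then show ?thesis by (simp add: has_vector_derivative_def has_derivative_bot bounded_linear_scaleR_left)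
  qed
  have "tt 0 \<le> tt m" using Suc.prems(1) by (intro partition_mono[of "Suc m"]) auto
  then have un: "{tt 0..tt (Suc m)} = {tt 0..tt m} \<union> {tt m..tt (Suc m)}"
    using Suc.prems(1) by (auto dest: less_imp_le)
  have "(f has_vector_derivative f' t) (at t within {tt 0..tt m})"
    using Suc.IH[of t] Suc.prems outside by (cases "t \<in> {tt 0..tt m}") auto
  moreover have "(f has_vector_derivative f' t) (at t within {tt m..tt (Suc m)})"
    using Suc.prems outside by (cases "t \<in> {tt m..tt (Suc m)}") auto
  ultimately show ?case unfolding un by (rule has_vector_derivative_within_Un)
qed

section \<open>Linear systems of differential equations\<close>

text \<open>An energy argument: the sum \<open>E\<close> of squared norms satisfies
  \<open>E' \<le> C * E\<close>, so \<open>exp (- C * s) * E s\<close> cannot increase from its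
  initial value zero.\<close>

lemma gronwall_zero:
  fixes y y' :: "nat \<Rightarrow> real \<Rightarrow> 'a::real_inner"
  assumes der: "\<And>k t. k < N \<Longrightarrow> t \<in> {c..d} \<Longrightarrow>
      (y k has_vector_derivative y' k t) (at t within {c..d})"
    and bound: "\<And>k t. k < N \<Longrightarrow> t \<in> {c..d} \<Longrightarrow> norm (y' k t) \<le> K * (\<Sum>j<N. norm (y j t))"
    and init: "\<And>k. k < N \<Longrightarrow> y k c = 0" and "0 \<le> K"
    and "k < N" "t \<in> {c..d}"
  shows "y k t = 0"
proof -
  define E where "E s = (\<Sum>k<N. y k s \<bullet> y k s)" for s
  define E' where "E' s = (\<Sum>k<N. 2 * (y k s \<bullet> y' k s))" for s
  \<comment> \<open>The factor 2 comes from differentiating squares, and \<open>N\<close> from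
    bounding the square of a sum of \<open>N\<close> norms by \<open>N\<close> times the sum of
    their squares.\<close>
  define C where "C = 2 * K * N"
  have E'_le: "E' s \<le> C * E s" if "s \<in> {c..d}" for s
  proof -
    let ?S = "\<Sum>j<N. norm (y j s)"
    have "E' s \<le> (\<Sum>k<N. 2 * (norm (y k s) * (K * ?S)))"
      unfolding E'_def
    proof (rule sum_mono)
      fix k assume "k \<in> {..<N}"
      then have "y k s \<bullet> y' k s \<le> norm (y k s) * (K * ?S)"
        using norm_cauchy_schwarz[of "y k s" "y' k s"] bound[of k s] that
        by (meson lessThan_iff mult_left_mono norm_ge_zero order_trans)
      then show "2 * (y k s \<bullet> y' k s) \<le> 2 * (norm (y k s) * (K * ?S))" by simp
    qed
    also have "\<dots> = 2 * K * ?S\<^sup>2"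
      by (simp add: sum_distrib_left[symmetric] sum_distrib_right[symmetric] power2_eq_square)
    also have "\<dots> \<le> 2 * K * (N * (\<Sum>j<N. (norm (y j s))\<^sup>2))"
      using sum_squared_le_sum_of_squares[of "\<lambda>j. norm (y j s)" "{..<N}"] \<open>0 \<le> K\<close>
      by (intro mult_left_mono) (auto simp: mult.commute)
    also have "\<dots> = C * E s" by (simp add: C_def E_def power2_norm_eq_inner)
    finally show ?thesis .
  qed
  define g where "g s = exp (- C * s) * E s" for s
  have gder: "(g has_derivative (\<lambda>h. h * (exp (- C * s) * (E' s - C * E s)))) (at s within {c..t})"
    if "s \<in> {c..t}" for s
  proof -
    have s: "s \<in> {c..d}" using that assms(6) by auto
    have "((\<lambda>s. y k s \<bullet> y k s) has_vector_derivative 2 * (y k s \<bullet> y' k s)) (at s within {c..t})"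
      if "k < N" for k
    proof -
      have "(y k has_vector_derivative y' k s) (at s within {c..t})"
        using der[OF that s] assms(6) by (auto intro: has_vector_derivative_within_subset)
      from bounded_bilinear.has_vector_derivative[OF bounded_bilinear_inner this this]
      show ?thesis by (simp add: inner_commute)
    qed
    then have "(E has_vector_derivative E' s) (at s within {c..t})"
      unfolding E_def E'_def by (intro has_vector_derivative_sum) auto
    then have "(E has_real_derivative E' s) (at s within {c..t})"
      by (simp add: has_real_derivative_iff_has_vector_derivative)
    then have "(g has_real_derivative exp (- C * s) * (E' s - C * E s)) (at s within {c..t})"
      unfolding g_def by (auto intro!: derivative_eq_intros simp: algebra_simps)
    then show ?thesis by (simp add: has_field_derivative_def mult_commute_abs)
  qed
  \<comment> \<open>A single mean value step from \<open>c\<close> to \<open>t\<close> is enough: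
    the derivative of \<open>g\<close> at the intermediate point is nonpositive and
    \<open>g c = 0\<close>.\<close>
  obtain s where s: "s \<in> {c..t}" "g t - g c = (t - c) * (exp (- C * s) * (E' s - C * E s))"
    using mvt_very_simple[of c t g "\<lambda>s h. h * (exp (- C * s) * (E' s - C * E s))"] gder assms(6)
    by auto
  have "(t - c) * (exp (- C * s) * (E' s - C * E s)) \<le> 0"
    using E'_le[of s] s(1) assms(6) by (intro mult_nonneg_nonpos) auto
  then have "g t \<le> 0" using s(2) init by (simp add: g_def E_def)
  then have "E t \<le> 0" by (simp add: g_def mult_le_0_iff)
  then have "E t = 0" unfolding E_def by (intro antisym sum_nonneg) auto
  then show ?thesis using assms(5) by (simp add: E_def sum_nonneg_eq_0_iff)
qed

lemma matrix_family_bound: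
  fixes M :: "nat \<Rightarrow> nat \<Rightarrow> real \<Rightarrow> real^'n^'m"
  assumes "compact S" "\<And>k j. k < N \<Longrightarrow> j < N' \<Longrightarrow> continuous_on S (M k j)"
  obtains K where "0 \<le> K"
    "\<And>k j t x. k < N \<Longrightarrow> j < N' \<Longrightarrow> t \<in> S \<Longrightarrow> norm (M k j t *v x) \<le> K * norm x"
proof -
  obtain B where B: "0 \<le> B" "\<And>a x. norm ((a::real^'n^'m) *v x) \<le> norm a * norm x * B"
    using bounded_bilinear.nonneg_bounded[OF bounded_bilinear_matrix_vector_mult] by blast
  have "\<exists>b\<ge>0. \<forall>t\<in>S. norm (M k j t) \<le> b" if kj: "k < N" "j < N'" for k j
  proof -
    have "bounded (M k j ` S)"
      using compact_imp_bounded compact_continuous_image assms kj by blast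
    then show ?thesis unfolding bounded_pos by (auto intro: less_imp_le)
  qed
  then obtain b where b: "\<And>k j. k < N \<Longrightarrow> j < N' \<Longrightarrow> 0 \<le> b k j \<and> (\<forall>t\<in>S. norm (M k j t) \<le> b k j)"
    by metis
  \<comment> \<open>A sum of nonnegative bounds instead of their maximum, so that empty index ranges
    need no separate treatment.\<close>
  define K where "K = (\<Sum>k<N. \<Sum>j<N'. b k j) * B"
  have bK: "b k j * B \<le> K" if "k < N" "j < N'" for k j
  proof -
    have "b k j \<le> (\<Sum>j<N'. b k j)" using that b by (intro member_le_sum) auto
    also have "\<dots> \<le> (\<Sum>k<N. \<Sum>j<N'. b k j)"
      using that b by (intro member_le_sum[of k _ "\<lambda>k. \<Sum>j<N'. b k j"] sum_nonneg) auto
    finally show ?thesis unfolding K_def using B(1) by (rule mult_right_mono)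
  qed
  show ?thesis
  proof
    show "0 \<le> K" unfolding K_def using b B(1) by (auto intro!: mult_nonneg_nonneg sum_nonneg)
    fix k j t and x :: "real^'n" assume kj: "k < N" "j < N'" "t \<in> S"
    have "norm (M k j t *v x) \<le> norm (M k j t) * norm x * B" by (rule B(2))
    also have "\<dots> \<le> b k j * norm x * B" using b kj B(1) by (intro mult_right_mono) auto
    also have "\<dots> \<le> K * norm x"
      using mult_right_mono[OF bK[OF kj(1,2)] norm_ge_zero[of x]] by (simp add: ac_simps)
    finally show "norm (M k j t *v x) \<le> K * norm x" .
  qed
qed

text \<open>The solution is the sum of the Picard increments, which are dominated by the
  exponential series.\<close>

lemma linear_system_exists:
  fixes M :: "nat \<Rightarrow> nat \<Rightarrow> real \<Rightarrow> real^'n^'n" and x0 :: "nat \<Rightarrow> real^'n"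
  assumes cont: "\<And>k j. k < N \<Longrightarrow> j < N \<Longrightarrow> continuous_on {c..d} (M k j)"
  shows "\<exists>X. \<forall>k<N. X k c = x0 k \<and> (\<forall>t\<in>{c..d}.
    (X k has_vector_derivative (\<Sum>j<N. M k j t *v X j t)) (at t within {c..d}))"
proof -
  obtain K where K: "0 \<le> K"
    "\<And>k j t x. k < N \<Longrightarrow> j < N \<Longrightarrow> t \<in> {c..d} \<Longrightarrow> norm (M k j t *v x) \<le> K * norm x"
    by (rule matrix_family_bound[where M=M and N=N and N'=N, OF compact_Icc cont]) auto
  define Y where "Y = rec_nat (\<lambda>k t. x0 k)
    (\<lambda>_ Yr k t. integral {c..t} (\<lambda>s. \<Sum>j<N. M k j s *v Yr j s))"
  define Z where "Z r k s = (\<Sum>j<N. M k j s *v Y r j s)" for r k s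
  have Y0: "Y 0 k t = x0 k" and YS: "Y (Suc r) k t = integral {c..t} (Z r k)" for r k t
    by (simp_all add: Y_def Z_def[abs_def])
  have Ycont: "k < N \<Longrightarrow> continuous_on {c..d} (Y r k)" for r k
  proof (induction r arbitrary: k)
    case 0
    then show ?case using Y0 by (simp add: continuous_on_cong[of _ _ "Y 0 k" "\<lambda>_. x0 k"])
  next
    case (Suc r)
    have "continuous_on {c..d} (Z r k)"
      unfolding Z_def using Suc cont by (intro continuous_on_sum continuous_on_matrix_vector_mult) auto
    then have "continuous_on {c..d} (\<lambda>t. integral {c..t} (Z r k))"
      by (intro indefinite_integral_continuous_1 integrable_continuous_real)
    then show ?case using YS by (simp add: continuous_on_cong[of _ _ "Y (Suc r) k" "\<lambda>t. integral {c..t} (Z r k)"])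
  qed
  have Zcont: "continuous_on {c..d} (Z r k)" if "k < N" for r k
    unfolding Z_def using that Ycont cont by (intro continuous_on_sum continuous_on_matrix_vector_mult) auto
  define C where "C = (\<Sum>k<N. norm (x0 k))"
  have C0: "0 \<le> C" unfolding C_def by (intro sum_nonneg) auto
  \<comment> \<open>Each component of the right-hand side has \<open>N\<close> terms, each of size
    at most \<open>K\<close> times a common bound on the state.\<close>
  define L where "L = N * K"
  have L0: "0 \<le> L" unfolding L_def using K(1) by simp
  have Zb: "norm (Z r k t) \<le> L * B"
    if "k < N" "t \<in> {c..d}" "\<And>j. j < N \<Longrightarrow> norm (Y r j t) \<le> B" for r k t B
  proof -
    have "norm (M k j t *v Y r j t) \<le> K * B" if "j < N" for j
      using K(2)[of k j t "Y r j t"] \<open>\<And>j. j < N \<Longrightarrow> norm (Y r j t) \<le> B\<close>[OF that]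
        mult_left_mono[OF _ K(1)] that \<open>k < N\<close> \<open>t \<in> {c..d}\<close> by (meson order_trans)
    then have "norm (Z r k t) \<le> (\<Sum>j<N. K * B)" unfolding Z_def by (intro sum_norm_le) auto
    then show ?thesis by (simp add: L_def)
  qed
  have Yb: "norm (Y r k t) \<le> C * (L * (t - c)) ^ r / fact r" if "k < N" "t \<in> {c..d}" for r k t
    using that
  proof (induction r arbitrary: k t)
    case 0
    then show ?case unfolding C_def Y0 by (simp add: member_le_sum[of k "{..<N}" "\<lambda>k. norm (x0 k)"])
  next
    case (Suc r)
    define b where "b s = L * (C * (L * (s - c)) ^ r / fact r)" for s
    have "((\<lambda>s. C * (L * (s - c)) ^ Suc r / fact (Suc r)) has_vector_derivative b s)
        (at s within {c..t})" for s
      unfolding has_real_derivative_iff_has_vector_derivative[symmetric] b_def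
      by (rule derivative_eq_intros refl | simp del: power_Suc)+
    then have "(b has_integral (C * (L * (t - c)) ^ Suc r / fact (Suc r)
        - C * (L * (c - c)) ^ Suc r / fact (Suc r))) {c..t}"
      using Suc.prems by (intro fundamental_theorem_of_calculus) auto
    then have b: "(b has_integral C * (L * (t - c)) ^ Suc r / fact (Suc r)) {c..t}" by simp
    have "norm (integral {c..t} (Z r k)) \<le> integral {c..t} b"
    proof (rule integral_norm_bound_integral)
      show "Z r k integrable_on {c..t}"
        using continuous_on_subset[OF Zcont[OF Suc.prems(1)], of "{c..t}"] Suc.prems
        by (intro integrable_continuous_real) auto
      show "b integrable_on {c..t}" using b by blast
      show "norm (Z r k s) \<le> b s" if "s \<in> {c..t}" for s
        unfolding b_def using that Suc by (intro Zb) auto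
    qed
    then show ?case using integral_unique[OF b] by (simp add: YS)
  qed
  have Yb': "norm (Y r k t) \<le> C * ((L * (d - c)) ^ r / fact r)" if "k < N" "t \<in> {c..d}" for r k t
  proof -
    have "(L * (t - c)) ^ r \<le> (L * (d - c)) ^ r"
      using that L0 by (intro power_mono mult_left_mono) auto
    then have "C * (L * (t - c)) ^ r / fact r \<le> C * (L * (d - c)) ^ r / fact r"
      using C0 by (intro divide_right_mono mult_left_mono) auto
    then show ?thesis using Yb[OF that, of r] by simp
  qed
  have summ: "summable (\<lambda>r. B * ((L * (d - c)) ^ r / fact r))" for B
    using summable_exp[of "L * (d - c)"] by (intro summable_mult) (simp add: field_simps)
  define X where "X k t = (\<Sum>r. Y r k t)" for k t
  have Xlim: "uniform_limit {c..d} (\<lambda>n t. \<Sum>r<n. Y r k t) (X k) sequentially" if "k < N" for k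
    unfolding X_def using Yb' that by (intro Weierstrass_m_test[OF _ summ]) auto
  have Xsums: "(\<lambda>r. Y r k t) sums X k t" if "k < N" "t \<in> {c..d}" for k t
    unfolding sums_def using tendsto_uniform_limitI[OF Xlim] that by blast
  have Xcont: "continuous_on {c..d} (X k)" if "k < N" for k
    using that Ycont by (intro uniform_limit_theorem[OF _ Xlim]) (auto intro!: always_eventually continuous_on_sum)
  define G where "G k s = (\<Sum>j<N. M k j s *v X j s)" for k s
  have Gcont: "continuous_on {c..d} (G k)" if "k < N" for k
    unfolding G_def using that Xcont cont by (intro continuous_on_sum continuous_on_matrix_vector_mult) auto
  have Zsums: "(\<lambda>r. Z r k s) sums G k s" if "k < N" "s \<in> {c..d}" for k s
    unfolding Z_def G_def using that Xsums
    by (intro sums_sum bounded_linear.sums[OF bounded_bilinear.bounded_linear_right[OF bounded_bilinear_matrix_vector_mult]]) auto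
  have Zlim: "uniform_limit {c..d} (\<lambda>n s. \<Sum>r<n. Z r k s) (G k) sequentially" if "k < N" for k
  proof -
    have "norm (Z r k s) \<le> (L * C) * ((L * (d - c)) ^ r / fact r)" if "s \<in> {c..d}" for r s
      using Zb[OF \<open>k < N\<close> that Yb'[OF _ that], of r] by (simp add: mult.assoc)
    then have "uniform_limit {c..d} (\<lambda>n s. \<Sum>r<n. Z r k s) (\<lambda>s. \<Sum>r. Z r k s) sequentially"
      by (intro Weierstrass_m_test[OF _ summ]) auto
    then show ?thesis
      using Zsums[OF that] by (subst uniform_limit_cong'[where g="\<lambda>n s. \<Sum>r<n. Z r k s" and i="\<lambda>s. \<Sum>r. Z r k s"])
        (auto simp: sums_iff)
  qed
  have XG: "X k t = x0 k + integral {c..t} (G k)" if kt: "k < N" "t \<in> {c..d}" for k t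
  proof -
    have sub: "{c..t} \<subseteq> {c..d}" using kt by auto
    have "continuous_on {c..t} (\<lambda>s. \<Sum>r<n. Z r k s)" for n
      using continuous_on_subset[OF Zcont[OF kt(1)] sub] by (intro continuous_on_sum) auto
    then obtain I J where IJ: "\<And>n. ((\<lambda>s. \<Sum>r<n. Z r k s) has_integral I n) {c..t}"
      "(G k has_integral J) {c..t}" "I \<longlonglongrightarrow> J"
      using uniform_limit_integral[OF uniform_limit_on_subset[OF Zlim[OF kt(1)] sub]]
      by (metis trivial_limit_sequentially)
    have "((\<lambda>s. \<Sum>r<n. Z r k s) has_integral (\<Sum>r<n. Y (Suc r) k t)) {c..t}" for n
      unfolding YS using continuous_on_subset[OF Zcont[OF that(1)] sub]
      by (intro has_integral_sum integrable_integral integrable_continuous_real) auto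
    then have "I n = (\<Sum>r<n. Y (Suc r) k t)" for n using IJ(1) has_integral_unique by blast
    \<comment> \<open>The index shift is the fixed-point property: integrating the image of
      increment \<open>r\<close> gives increment \<open>r + 1\<close>, so only the constant
      increment \<open>x0 k\<close> is missing from the sum.\<close>
    moreover have "(\<lambda>r. Y (Suc r) k t) sums (X k t - x0 k)"
      using Xsums[OF that] sums_Suc_iff[of "\<lambda>r. Y r k t"] by (simp add: Y0)
    ultimately have "J = X k t - x0 k"
      using IJ(3) LIMSEQ_unique unfolding sums_def by (metis (no_types, lifting) ext)
    then show ?thesis using integral_unique[OF IJ(2)] by simp
  qed
  have "(X k has_vector_derivative G k t) (at t within {c..d})" if "k < N" "t \<in> {c..d}" for k t
  proof -
    have "((\<lambda>t. x0 k + integral {c..t} (G k)) has_vector_derivative 0 + G k t) (at t within {c..d})"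
      using integral_has_vector_derivative[OF Gcont] that by (intro has_vector_derivative_add) auto
    then show ?thesis
      using XG that has_vector_derivative_transform[of t "{c..d}" "X k" "\<lambda>t. x0 k + integral {c..t} (G k)"] by auto
  qed
  moreover have "X k c = x0 k" if "k < N" for k
  proof -
    have "Y r k c = 0" if "r \<noteq> 0" for r
      using that by (cases r) (simp_all add: YS)
    then show ?thesis unfolding X_def by (subst suminf_finite[of "{0}"]) (auto simp: Y0)
  qed
  ultimately show ?thesis unfolding G_def by blast
qed

section \<open>Square linear systems over an arbitrary finite index set\<close>

text \<open>Gaussian elimination: either equation \<open>e\<close> is void, or it is solved for an
  unknown \<open>q\<close> with nonzero coefficient and substituted into the others, which lowers
  both counts by one.\<close>

lemma underdetermined_system_nontrivial:
  fixes A :: "'e \<Rightarrow> 'q \<Rightarrow> real"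
  assumes "finite E" "finite Q" "card E < card Q"
  shows "\<exists>x. (\<exists>j\<in>Q. x j \<noteq> 0) \<and> (\<forall>i\<in>E. (\<Sum>j\<in>Q. A i j * x j) = 0)"
  using assms
proof (induction E arbitrary: Q A rule: finite_induct)
  case empty
  then show ?case by (auto intro!: exI[of _ "\<lambda>_. 1"] simp: card_gt_0_iff)
next
  case (insert e E)
  show ?case
  proof (cases "\<forall>j\<in>Q. A e j = 0")
    case True
    moreover obtain x where "\<exists>j\<in>Q. x j \<noteq> 0" "\<forall>i\<in>E. (\<Sum>j\<in>Q. A i j * x j) = 0"
      using insert.IH[of Q A] insert.hyps insert.prems by (auto dest: Suc_lessD)
    ultimately show ?thesis by (intro exI[of _ x]) auto
  next
    case False
    then obtain q where q: "q \<in> Q" "A e q \<noteq> 0" by blast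
    let ?Q = "Q - {q}"
    have "finite ?Q" "card E < card ?Q" using insert.hyps insert.prems q(1) by auto
    then obtain x where x: "\<exists>j\<in>?Q. x j \<noteq> 0"
      "\<And>i. i \<in> E \<Longrightarrow> (\<Sum>j\<in>?Q. (A i j - A i q * A e j / A e q) * x j) = 0"
      using insert.IH[of ?Q "\<lambda>i j. A i j - A i q * A e j / A e q"] by blast
    define \<beta> where "\<beta> = (\<Sum>j\<in>?Q. A e j * x j)"
    \<comment> \<open>The remaining equations no longer contain \<open>q\<close>, so its value is
      free to be set to satisfy equation \<open>e\<close>.\<close>
    define z where "z = x(q := - \<beta> / A e q)"
    have split: "(\<Sum>j\<in>Q. A i j * z j) = (\<Sum>j\<in>?Q. A i j * x j) - A i q * \<beta> / A e q" for i
      using insert.prems(1) q(1) by (simp add: sum.remove[of Q q] z_def)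
    have "(\<Sum>j\<in>Q. A i j * z j) = 0" if "i \<in> E" for i
    proof -
      have "(\<Sum>j\<in>?Q. (A i j - A i q * A e j / A e q) * x j) =
          (\<Sum>j\<in>?Q. A i j * x j) - A i q / A e q * \<beta>"
        unfolding \<beta>_def by (simp add: left_diff_distrib sum_subtractf sum_distrib_left mult.assoc)
      then show ?thesis using x(2)[OF that] by (simp add: split)
    qed
    moreover have "(\<Sum>j\<in>Q. A e j * z j) = 0" using q(2) by (simp add: split \<beta>_def[symmetric])
    moreover have "\<exists>j\<in>Q. z j \<noteq> 0" using x(1) by (auto simp: z_def)
    ultimately show ?thesis by blast
  qed
qed

text \<open>The right-hand side becomes the column of an extra unknown \<open>None\<close>, which
  makes the system homogeneous with more unknowns than equations. A nontrivial solution has nonzero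
  \<open>None\<close> entry by the trivial kernel; dividing by that entry solves the original
  system.\<close>

lemma square_system_solvable:
  fixes A :: "'q \<Rightarrow> 'q \<Rightarrow> real"
  assumes "finite Q"
    and ker: "\<And>x. (\<And>i. i \<in> Q \<Longrightarrow> (\<Sum>j\<in>Q. A i j * x j) = 0) \<Longrightarrow> \<forall>j\<in>Q. x j = 0"
  obtains x where "\<And>i. i \<in> Q \<Longrightarrow> (\<Sum>j\<in>Q. A i j * x j) = r i"
proof -
  let ?Q = "insert None (Some ` Q)"
  obtain x where x: "\<exists>j\<in>?Q. x j \<noteq> 0"
    "\<And>i. i \<in> Q \<Longrightarrow> (\<Sum>j\<in>?Q. (case j of None \<Rightarrow> - r i | Some j \<Rightarrow> A i j) * x j) = 0"
    using underdetermined_system_nontrivial[of Q ?Q "\<lambda>i j. case j of None \<Rightarrow> - r i | Some j \<Rightarrow> A i j"]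
      assms(1) by (auto simp: card_image)
  have eq: "(\<Sum>j\<in>Q. A i j * x (Some j)) = r i * x None" if "i \<in> Q" for i
    using x(2)[OF that] assms(1) by (simp add: sum.reindex)
  have "x None \<noteq> 0"
  proof
    assume "x None = 0"
    then have "\<forall>j\<in>Q. x (Some j) = 0" using eq by (intro ker) auto
    then show False using x(1) \<open>x None = 0\<close> by auto
  qed
  then show ?thesis
    using eq by (intro that[of "\<lambda>j. x (Some j) / x None"]) (simp add: sum_divide_distrib[symmetric])
qed

section \<open>The Lagrange identity\<close>

text \<open>The quasi-derivatives of \<open>u\<close> are the Horner-type partial evaluations of the adjoint:
  number \<open>p\<close> is \<open>\<plusminus>u\<close>, number \<open>0\<close> is the adjoint itself, and each is obtained
  from the next one by a single differentiation.\<close>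

definition quasi_deriv ::
  "nat \<Rightarrow> (nat \<Rightarrow> real \<Rightarrow> real^'n^'n) \<Rightarrow> real set \<Rightarrow> (real \<Rightarrow> real^'n) \<Rightarrow> nat \<Rightarrow> real \<Rightarrow> real^'n" where
  "quasi_deriv p A S u k t = (-1)^p *\<^sub>R nderiv S (p - k) u t
     + (\<Sum>j\<in>{k..<p}. (-1)^(j+1) *\<^sub>R nderiv S (j - k) (\<lambda>\<tau>. transpose (A j \<tau>) *v u \<tau>) t)"

lemma quasi_deriv_0: "quasi_deriv p A S u 0 = Ladj p A S u"
  by (simp add: quasi_deriv_def[abs_def] Ladj_def[abs_def] atLeast0LessThan)

lemma quasi_deriv_p: "quasi_deriv p A S u p t = (-1)^p *\<^sub>R u t"
  by (simp add: quasi_deriv_def)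

lemma C_on_transpose_mult:
  fixes M :: "real \<Rightarrow> real^'n^'m"
  assumes "c < d" "C_on k {c..d} M" "C_on k {c..d} u"
  shows "C_on k {c..d} (\<lambda>t. transpose (M t) *v u t)"
  by (rule C_on_matrix_vector_mult[OF assms(1) C_on_transpose(1)[OF assms(1,2)] assms(3)])

text \<open>Differentiation raises the order of every summand by one and so produces number
  \<open>k\<close> without its undifferentiated summand \<open>j = k\<close>; the additional term
  makes up for that summand.\<close>

lemma quasi_deriv_has_vector_derivative:
  fixes A :: "nat \<Rightarrow> real \<Rightarrow> real^'n^'n"
  assumes "c < d" and A: "\<And>j. j < p \<Longrightarrow> C_on p {c..d} (A j)" and u: "C_on p {c..d} u"
    and "k < p" "t \<in> {c..d}"
  shows "(quasi_deriv p A {c..d} u (Suc k) has_vector_derivative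
    quasi_deriv p A {c..d} u k t + (-1)^k *\<^sub>R (transpose (A k t) *v u t)) (at t within {c..d})"
proof -
  let ?v = "\<lambda>j \<tau>. transpose (A j \<tau>) *v u \<tau>"
  let ?S = "{c..d}"
  have v: "C_on p ?S (?v j)" if "j < p" for j
    using A[OF that] u assms(1) by (intro C_on_transpose_mult)
  have 1: "(nderiv ?S (p - Suc k) u has_vector_derivative nderiv ?S (p - k) u t) (at t within ?S)"
    using C_on_has_vector_derivative[OF u, of "p - Suc k" t] assms by (simp add: Suc_diff_Suc del: nderiv.simps)
  have 2: "(nderiv ?S (j - Suc k) (?v j) has_vector_derivative nderiv ?S (j - k) (?v j) t) (at t within ?S)"
    if "j \<in> {Suc k..<p}" for j
  proof -
    have "j < p" "j - Suc k < p" "Suc (j - Suc k) = j - k" using that by auto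
    then show ?thesis using C_on_has_vector_derivative[OF v, of j "j - Suc k" t] assms(5) by metis
  qed
  have "(quasi_deriv p A ?S u (Suc k) has_vector_derivative
      (-1)^p *\<^sub>R nderiv ?S (p - k) u t
      + (\<Sum>j\<in>{Suc k..<p}. (-1)^(j+1) *\<^sub>R nderiv ?S (j - k) (?v j) t)) (at t within ?S)"
    unfolding quasi_deriv_def[abs_def]
    by (intro has_vector_derivative_add has_vector_derivative_sum
        bounded_linear.has_vector_derivative[OF bounded_linear_scaleR_right] 1 2) auto
  also have "(-1)^p *\<^sub>R nderiv ?S (p - k) u t
      + (\<Sum>j\<in>{Suc k..<p}. (-1)^(j+1) *\<^sub>R nderiv ?S (j - k) (?v j) t) =
      quasi_deriv p A ?S u k t + (-1)^k *\<^sub>R (?v k t)"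
    using sum.atLeast_Suc_lessThan[OF \<open>k < p\<close>, of "\<lambda>j. (-1)^(j+1) *\<^sub>R nderiv ?S (j - k) (?v j) t"]
    by (simp add: quasi_deriv_def)
  finally show ?thesis .
qed

text \<open>The recursion determines the family downwards from its top member, because
  \<open>w k\<close> can be read off the derivative of \<open>w (Suc k)\<close>. It serves to
  recognise the components of a first-order system as quasi-derivatives.\<close>

lemma quasi_deriv_eqI:
  fixes A :: "nat \<Rightarrow> real \<Rightarrow> real^'n^'n" and w :: "nat \<Rightarrow> real \<Rightarrow> real^'n"
  assumes cd: "c < d" and A: "\<And>j. j < p \<Longrightarrow> C_on p {c..d} (A j)" and u: "C_on p {c..d} u"
    and wp: "\<And>t. t \<in> {c..d} \<Longrightarrow> w p t = (-1)^p *\<^sub>R u t"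
    and w: "\<And>k t. k < p \<Longrightarrow> t \<in> {c..d} \<Longrightarrow> (w (Suc k) has_vector_derivative
       w k t + (-1)^k *\<^sub>R (transpose (A k t) *v u t)) (at t within {c..d})"
    and "k \<le> p" "t \<in> {c..d}"
  shows "w k t = quasi_deriv p A {c..d} u k t"
  using assms(6,7)
proof (induction k arbitrary: t rule: inc_induct)
  case base
  then show ?case by (simp add: wp quasi_deriv_p)
next
  case (step k)
  let ?q = "quasi_deriv p A {c..d} u"
  have "(w (Suc k) has_vector_derivative ?q k t + (-1)^k *\<^sub>R (transpose (A k t) *v u t))
      (at t within {c..d})"
    using has_vector_derivative_transform[of t "{c..d}" "w (Suc k)" "?q (Suc k)"]
      quasi_deriv_has_vector_derivative[where A=A, OF cd A u step.hyps(2) step.prems] step by auto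
  then have "w k t + (-1)^k *\<^sub>R (transpose (A k t) *v u t)
      = ?q k t + (-1)^k *\<^sub>R (transpose (A k t) *v u t)"
    using has_vector_derivative_Icc_unique[OF cd step.prems] w[OF step.hyps(2) step.prems] by metis
  then show ?case by simp
qed

text \<open>The bilinear concomitant: the boundary term left by repeated integration by
  parts.\<close>

definition lagrange_form where
  "lagrange_form p A S h u t = (\<Sum>k<p. (-1)^k * (nderiv S k h t \<bullet> quasi_deriv p A S u (Suc k) t))"

lemma lagrange_identity:
  fixes A :: "nat \<Rightarrow> real \<Rightarrow> real^'n^'n"
  assumes cd: "c < d" and A: "\<And>j. j < p \<Longrightarrow> C_on p {c..d} (A j)"
    and h: "C_on p {c..d} h" and u: "C_on p {c..d} u" and t: "t \<in> {c..d}"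
  shows "(lagrange_form p A {c..d} h u has_vector_derivative
    h t \<bullet> Ladj p A {c..d} u t - Lop p A {c..d} h t \<bullet> u t) (at t within {c..d})"
proof -
  let ?q = "quasi_deriv p A {c..d} u"
  let ?D = "\<lambda>k. nderiv {c..d} k h"
  define a where "a k = (-1)^k * (?D k t \<bullet> ?q k t)" for k
  let ?d = "\<lambda>k. (-1)^k * (?D k t \<bullet> (?q k t + (-1)^k *\<^sub>R (transpose (A k t) *v u t))
       + ?D (Suc k) t \<bullet> ?q (Suc k) t)"
  have D: "(lagrange_form p A {c..d} h u has_vector_derivative (\<Sum>k<p. ?d k)) (at t within {c..d})"
    unfolding lagrange_form_def[abs_def]
    by (intro has_vector_derivative_sum has_vector_derivative_mult_right
        bounded_bilinear.has_vector_derivative[OF bounded_bilinear_inner]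
        C_on_has_vector_derivative[OF h] quasi_deriv_has_vector_derivative[OF cd A u] t) auto
  \<comment> \<open>The two signs of the coefficient term multiply to 1, and transposition moves the
    coefficient onto \<open>h\<close>. What remains is a telescoping difference whose ends give the
    adjoint and the leading term of \<open>L h\<close>.\<close>
  have dk: "?d k = (a k - a (Suc k)) + (A k t *v ?D k t) \<bullet> u t" for k
  proof -
    have "?D k t \<bullet> (transpose (A k t) *v u t) = (A k t *v ?D k t) \<bullet> u t"
      by (simp add: transpose_matrix_vector dot_lmul_matrix inner_commute)
    then show ?thesis
      by (simp add: a_def inner_add_right distrib_left mult.assoc[symmetric]
          power_mult_distrib[symmetric] del: nderiv.simps)
  qed
  have "a 0 - a p = h t \<bullet> Ladj p A {c..d} u t - ?D p t \<bullet> u t"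
    by (simp add: a_def quasi_deriv_0 quasi_deriv_p mult.assoc[symmetric] power_mult_distrib[symmetric])
  then have "(\<Sum>k<p. ?d k) = h t \<bullet> Ladj p A {c..d} u t - Lop p A {c..d} h t \<bullet> u t"
    unfolding dk by (simp add: sum.distrib sum_lessThan_telescope' Lop_def inner_diff_left inner_sum_left)
  with D show ?thesis by simp
qed

lemma lagrange_integral:
  fixes A :: "nat \<Rightarrow> real \<Rightarrow> real^'n^'n"
  assumes cd: "c < d" and A: "\<And>j. j < p \<Longrightarrow> C_on p {c..d} (A j)"
    and h: "C_on p {c..d} h" and u: "C_on p {c..d} u"
    and 0: "\<And>t. t \<in> {c..d} \<Longrightarrow> Ladj p A {c..d} u t = 0"
  shows "((\<lambda>t. Lop p A {c..d} h t \<bullet> u t) has_integral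
    lagrange_form p A {c..d} h u c - lagrange_form p A {c..d} h u d) {c..d}"
proof -
  have "((\<lambda>t. h t \<bullet> Ladj p A {c..d} u t - Lop p A {c..d} h t \<bullet> u t) has_integral
    lagrange_form p A {c..d} h u d - lagrange_form p A {c..d} h u c) {c..d}"
    using lagrange_identity[OF cd A h u] cd by (intro fundamental_theorem_of_calculus) auto
  then have "((\<lambda>t. - (Lop p A {c..d} h t \<bullet> u t)) has_integral
    lagrange_form p A {c..d} h u d - lagrange_form p A {c..d} h u c) {c..d}"
    by (rule has_integral_eq[rotated]) (simp add: 0)
  from has_integral_neg[OF this] show ?thesis by simp
qed

section \<open>The operator on smooth functions\<close>

lemma C_on_Lop:
  assumes "c < d" "C_on (k + p) {c..d} g" "\<And>j. j < p \<Longrightarrow> C_on k {c..d} (A j)"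
  shows "C_on k {c..d} (Lop p A {c..d} g)"
proof -
  have "C_on k {c..d} (nderiv {c..d} j g)" if "j \<le> p" for j
    using C_on_nderiv[OF C_on_mono[OF assms(2)], of k j] that by auto
  then show ?thesis unfolding Lop_def[abs_def] using assms
    by (intro C_on_diff C_on_sum C_on_matrix_vector_mult) auto
qed

lemma Lop_subinterval:
  assumes "C_on p {a..b} g" "{c..d} \<subseteq> {a..b}" "c < d" "t \<in> {c..d}"
  shows "Lop p A {c..d} g t = Lop p A {a..b} g t"
  using C_on_subinterval(2)[OF assms(1-3)] assms(4) by (simp add: Lop_def)

lemma Lop_add:
  assumes "c < d" "C_on p {c..d} f" "C_on p {c..d} g" "t \<in> {c..d}"
  shows "Lop p A {c..d} (\<lambda>t. f t + g t) t = Lop p A {c..d} f t + Lop p A {c..d} g t"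
  using C_on_add(2)[OF assms(1-3)] assms(4)
  by (simp add: Lop_def matrix_vector_right_distrib sum.distrib)

text \<open>The derivatives of order below \<open>p\<close> form a first-order companion system with
  zero initial value, to which the energy estimate applies.\<close>

lemma Lop_zero_unique:
  fixes A :: "nat \<Rightarrow> real \<Rightarrow> real^'n^'n"
  assumes "c < d" and h: "C_on p {c..d} h" and A: "\<And>j. j < p \<Longrightarrow> continuous_on {c..d} (A j)"
    and L0: "\<And>t. t \<in> {c..d} \<Longrightarrow> Lop p A {c..d} h t = 0"
    and "\<And>k. k < p \<Longrightarrow> nderiv {c..d} k h c = 0"
    and "k < p" "t \<in> {c..d}"
  shows "nderiv {c..d} k h t = 0"
proof -
  let ?y = "\<lambda>k. nderiv {c..d} k h"
  obtain K where K: "0 \<le> K"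
    "\<And>k j t x. k < (1::nat) \<Longrightarrow> j < p \<Longrightarrow> t \<in> {c..d} \<Longrightarrow> norm (A j t *v x) \<le> K * norm x"
    by (rule matrix_family_bound[where M="\<lambda>_. A" and N=1 and N'=p, OF compact_Icc A]) auto
  \<comment> \<open>In \<open>1 + K\<close>, the 1 serves the shift equations and \<open>K\<close>
    the last one, where \<open>L h = 0\<close> expresses the derivative of order \<open>p\<close> by
    the lower ones.\<close>
  have "norm (?y (Suc k) t) \<le> (1 + K) * (\<Sum>j<p. norm (?y j t))" if "k < p" "t \<in> {c..d}" for k t
  proof (cases "Suc k < p")
    case True
    then have "norm (?y (Suc k) t) \<le> (\<Sum>j<p. norm (?y j t))"
      by (intro member_le_sum[of "Suc k" "{..<p}" "\<lambda>j. norm (?y j t)"]) auto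
    also have "\<dots> \<le> (1 + K) * (\<Sum>j<p. norm (?y j t))"
      using K(1) by (simp add: distrib_right sum_nonneg)
    finally show ?thesis .
  next
    case False
    then have [simp]: "Suc k = p" using that by simp
    have "?y p t = (\<Sum>j<p. A j t *v ?y j t)" using L0[OF that(2)] by (simp add: Lop_def)
    also have "norm \<dots> \<le> (\<Sum>j<p. K * norm (?y j t))" using K(2)[of 0] that by (intro sum_norm_le) auto
    also have "\<dots> \<le> (1 + K) * (\<Sum>j<p. norm (?y j t))"
      by (simp add: distrib_right sum_nonneg sum_distrib_left[symmetric])
    finally show ?thesis by (simp del: nderiv.simps)
  qed
  from gronwall_zero[where y="?y" and y'="\<lambda>k. ?y (Suc k)", OF C_on_has_vector_derivative[OF h] this assms(5) _ assms(6,7)]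
  show ?thesis using K(1) by simp
qed

section \<open>Piecewise functions on a partition\<close>

lemma has_integral_partition:
  fixes f :: "real \<Rightarrow> 'a::banach"
  assumes "\<forall>i<m. tt i < tt (Suc i)"
    and "\<And>i. i < m \<Longrightarrow> (f has_integral v i) {tt i..tt (Suc i)}"
  shows "(f has_integral (\<Sum>i<m. v i)) {tt 0..tt m}"
  using assms
proof (induction m)
  case 0
  then show ?case using has_integral_refl(2)[of f "tt 0"] by (simp add: cbox_interval)
next
  case (Suc m)
  have "tt 0 \<le> tt m" "tt m \<le> tt (Suc m)"
    using Suc.prems(1) by (auto intro: partition_mono[of "Suc m"])
  then show ?case using has_integral_combine[of "tt 0" "tt m" "tt (Suc m)" f] Suc by simp
qed

lemma partition_cover:
  fixes tt :: "nat \<Rightarrow> real"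
  assumes "1 \<le> m" "t \<in> {tt 0..tt m}"
  shows "\<exists>i<m. t \<in> {tt i..tt (Suc i)}"
  using assms
proof (induction m rule: nat_induct_at_least)
  case (Suc m)
  then show ?case by (cases "t \<le> tt m") (auto intro: less_SucI)
qed auto

section \<open>Minimality of splines\<close>

locale spline_problem =
  fixes p m :: nat and tt :: "nat \<Rightarrow> real" and A :: "nat \<Rightarrow> real \<Rightarrow> real^'n^'n"
  assumes p: "1 \<le> p" and A: "\<And>j. j < p \<Longrightarrow> C_on p {tt 0..tt m} (A j)"
    and m: "1 \<le> m" and mesh: "\<forall>i<m. tt i < tt (Suc i)"
begin

abbreviation "ab \<equiv> {tt 0..tt m}"
abbreviation "I i \<equiv> {tt i..tt (Suc i)}"

section \<open>Comparison of the pieces with the whole interval\<close>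

lemma I_subset: "i < m \<Longrightarrow> I i \<subseteq> ab"
  using partition_mono[OF mesh, of 0 i] partition_mono[OF mesh, of "Suc i" m] by auto

lemma ab: "tt 0 < tt m"
  using partition_strict_mono[OF mesh, of 0 m] m by auto

lemma A_I: "i < m \<Longrightarrow> j < p \<Longrightarrow> C_on p (I i) (A j)"
  using C_on_subinterval(1)[OF A I_subset] mesh by blast

lemma OmegaD:
  assumes "g \<in> Omega p tt m"
  shows "C_on (2*p-2) ab g" "\<And>i. i < m \<Longrightarrow> C_on (2*p) (I i) g" "\<And>i. i < m \<Longrightarrow> C_on p (I i) g"
  using assms C_on_mono[of "2*p" _ g p] by (auto simp: Omega_def)

lemma C_on_Lop_I: "g \<in> Omega p tt m \<Longrightarrow> i < m \<Longrightarrow> C_on p (I i) (Lop p A (I i) g)"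
  using mesh A_I OmegaD(2)[of g i] by (intro C_on_Lop) (auto simp: mult_2)

lemma continuous_Lop_I: "g \<in> Omega p tt m \<Longrightarrow> i < m \<Longrightarrow> continuous_on (I i) (Lop p A (I i) g)"
  using C_on_continuous_nderiv[OF C_on_Lop_I, of g i 0] by simp

lemma nderiv_I_eq:
  assumes "g \<in> Omega p tt m" "i < m" "k < p" "t \<in> I i"
  shows "nderiv (I i) k g t = nderiv ab k g t"
  using C_on_subinterval(2)[OF OmegaD(1)[OF assms(1)] I_subset, of i k t] mesh assms by auto

text \<open>For \<open>1 \<le> k\<close>, number \<open>Suc k\<close> uses derivatives of
  \<open>L s\<close> of order at most \<open>p - 2\<close>, exactly the global smoothness of
  \<open>L s\<close>. The bounds on \<open>k\<close> force \<open>2 \<le> p\<close>, so the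
  subtraction is not truncated.\<close>

lemma quasi_deriv_I_eq:
  assumes s: "s \<in> Omega p tt m" and "i < m" "1 \<le> k" "k < p" "t \<in> I i"
  shows "quasi_deriv p A (I i) (Lop p A (I i) s) (Suc k) t =
    quasi_deriv p A ab (Lop p A ab s) (Suc k) t"
proof -
  let ?u = "Lop p A (I i) s" and ?U = "Lop p A ab s"
  have i: "tt i < tt (Suc i)" using mesh assms by auto
  have "C_on (p - 2 + p) ab s" using OmegaD(1)[OF s] assms by (simp add: mult_2)
  then have U: "C_on (p - 2) ab ?U" using A ab by (intro C_on_Lop) (auto intro: C_on_mono[of p])
  have AU: "C_on (p - 2) ab (\<lambda>\<tau>. transpose (A j \<tau>) *v ?U \<tau>)" if "j < p" for j
    using U C_on_mono[OF A[OF that], of "p - 2"] by (intro C_on_transpose_mult ab) auto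
  have "C_on p ab s" using C_on_mono[OF OmegaD(1)[OF s], of p] assms by linarith
  then have uU: "?u \<tau> = ?U \<tau>" if "\<tau> \<in> I i" for \<tau>
    using that assms I_subset i by (intro Lop_subinterval) auto
  have "nderiv (I i) k' ?u t = nderiv ab k' ?U t" if "k' \<le> p - 2" for k'
    using nderiv_cong[of "I i" ?u ?U t k'] uU C_on_subinterval(2)[OF U I_subset i that] assms by auto
  moreover have "nderiv (I i) k' (\<lambda>\<tau>. transpose (A j \<tau>) *v ?u \<tau>) t
      = nderiv ab k' (\<lambda>\<tau>. transpose (A j \<tau>) *v ?U \<tau>) t" if "k' \<le> p - 2" "j < p" for k' j
    using nderiv_cong[of "I i" "\<lambda>\<tau>. transpose (A j \<tau>) *v ?u \<tau>" "\<lambda>\<tau>. transpose (A j \<tau>) *v ?U \<tau>" t k']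
      uU C_on_subinterval(2)[OF AU I_subset i] that assms by auto
  ultimately show ?thesis using assms unfolding quasi_deriv_def
    by (intro arg_cong2[where f="(+)"] sum.cong arg_cong2[where f="(*\<^sub>R)"] refl) auto
qed

text \<open>At a knot the only quasi-derivative of \<open>L s\<close> that may jump is paired with the value
  of \<open>h\<close>, which vanishes there; so the boundary terms telescope.\<close>

lemma spline_orthogonal:
  assumes s: "s \<in> Omega p tt m" and h: "h \<in> Omega p tt m"
    and Ls: "\<And>i t. i < m \<Longrightarrow> t \<in> I i \<Longrightarrow> Ladj p A (I i) (Lop p A (I i) s) t = 0"
    and h0: "interp_bc p tt m (\<lambda>_. 0) (\<lambda>_. 0) (\<lambda>_. 0) h"
  shows "(\<Sum>i<m. integral (I i) (\<lambda>t. Lop p A (I i) h t \<bullet> Lop p A (I i) s t)) = 0"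
proof -
  \<comment> \<open>Formed only from derivatives within the whole interval, so both pieces meeting
    at a knot yield the same number there. Its sum starts at \<open>k = 1\<close>, and the end
    conditions on \<open>h\<close> make it vanish at both ends.\<close>
  define B where "B t = (\<Sum>k\<in>{1..<p}. (-1)^k *
    (nderiv ab k h t \<bullet> quasi_deriv p A ab (Lop p A ab s) (Suc k) t))" for t
  have B: "lagrange_form p A (I i) h (Lop p A (I i) s) t = B t" if "i < m" "t \<in> I i" "h t = 0" for i t
  proof -
    have "lagrange_form p A (I i) h (Lop p A (I i) s) t =
      (\<Sum>k\<in>{1..<p}. (-1)^k * (nderiv (I i) k h t \<bullet> quasi_deriv p A (I i) (Lop p A (I i) s) (Suc k) t))"
      unfolding lagrange_form_def using that(3) by (intro sum.mono_neutral_right) (auto simp: Suc_le_eq)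
    also have "\<dots> = B t" unfolding B_def
      using nderiv_I_eq[OF h] quasi_deriv_I_eq[OF s] that by (intro sum.cong) auto
    finally show ?thesis .
  qed
  have "integral (I i) (\<lambda>t. Lop p A (I i) h t \<bullet> Lop p A (I i) s t) = B (tt i) - B (tt (Suc i))"
    if "i < m" for i
  proof -
    have i: "tt i < tt (Suc i)" using mesh that by auto
    have "h (tt i) = 0" "h (tt (Suc i)) = 0" using h0 that by (auto simp: interp_bc_def)
    then have "lagrange_form p A (I i) h (Lop p A (I i) s) (tt i) = B (tt i)"
      "lagrange_form p A (I i) h (Lop p A (I i) s) (tt (Suc i)) = B (tt (Suc i))"
      using B[OF that] i by auto
    then show ?thesis
      using integral_unique[OF lagrange_integral[OF i A_I OmegaD(3)[OF h] C_on_Lop_I[OF s] Ls]] that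
      by simp
  qed
  then have "(\<Sum>i<m. integral (I i) (\<lambda>t. Lop p A (I i) h t \<bullet> Lop p A (I i) s t)) =
      (\<Sum>i<m. B (tt i) - B (tt (Suc i)))" by (intro sum.cong) auto
  also have "\<dots> = B (tt 0) - B (tt m)" by (rule sum_lessThan_telescope'[of "\<lambda>i. B (tt i)"])
  also have "B (tt 0) = 0" unfolding B_def using h0 by (intro sum.neutral) (auto simp: interp_bc_def)
  also have "B (tt m) = 0" unfolding B_def using h0 by (intro sum.neutral) (auto simp: interp_bc_def)
  finally show ?thesis by simp
qed

text \<open>The functional uses derivatives within the whole interval, whose values at a knot may be
  arbitrary when \<open>p = 1\<close>. The integrands agree on the open pieces, and the endpoints do
  not affect the integrals.\<close>

lemma Jfun_pieces:
  assumes "g \<in> Omega p tt m"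
  shows "Jfun p A (tt 0) (tt m) g =
    (\<Sum>i<m. integral (I i) (\<lambda>t. Lop p A (I i) g t \<bullet> Lop p A (I i) g t))"
  unfolding Jfun_def
proof (intro integral_unique has_integral_partition mesh)
  fix i assume i: "i < m"
  let ?f = "\<lambda>t. Lop p A (I i) g t \<bullet> Lop p A (I i) g t"
  have "(?f has_integral integral (I i) ?f) (I i)"
    using continuous_Lop_I[OF assms i]
    by (intro integrable_integral integrable_continuous_real continuous_intros)
  moreover have "Lop p A ab g t = Lop p A (I i) g t" if "t \<in> {tt i<..<tt (Suc i)}" for t
    by (simp add: Lop_def nderiv_interior[OF I_subset[OF i] that])
  ultimately show "((\<lambda>t. Lop p A ab g t \<bullet> Lop p A ab g t) has_integral integral (I i) ?f) (I i)"
    using has_integral_spike_interior[of ?f _ "tt i" "tt (Suc i)"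
        "\<lambda>t. Lop p A ab g t \<bullet> Lop p A ab g t"] by (auto simp: cbox_interval box_real)
qed

text \<open>Vanishing of the derivatives of order below \<open>p\<close> propagates from knot to
  knot: these orders do not exceed \<open>2p - 2\<close>, so both neighbouring pieces see the same
  values.\<close>

lemma Lop_zero_imp_zero:
  assumes h: "h \<in> Omega p tt m" and h0: "interp_bc p tt m (\<lambda>_. 0) (\<lambda>_. 0) (\<lambda>_. 0) h"
    and L0: "\<And>i t. i < m \<Longrightarrow> t \<in> I i \<Longrightarrow> Lop p A (I i) h t = 0" and t: "t \<in> ab"
  shows "h t = 0"
proof -
  have piece: "nderiv ab k h t = 0"
    if "i < m" "\<forall>k<p. nderiv ab k h (tt i) = 0" "k < p" "t \<in> I i" for i k t
  proof -
    have i: "tt i < tt (Suc i)" using mesh that by auto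
    have "nderiv (I i) k h t = 0"
    proof (rule Lop_zero_unique[OF i OmegaD(3)[OF h that(1)] _ L0[OF that(1)] _ that(3,4)])
      show "continuous_on (I i) (A j)" if "j < p" for j
        using C_on_continuous_nderiv[OF A_I[OF \<open>i < m\<close> that], of 0] by simp
      show "nderiv (I i) k h (tt i) = 0" if "k < p" for k
        using nderiv_I_eq[OF h \<open>i < m\<close> that, of "tt i"] i \<open>\<forall>k<p. nderiv ab k h (tt i) = 0\<close> that by simp
    qed
    then show ?thesis using nderiv_I_eq[OF h that(1,3,4)] by simp
  qed
  have knots: "i \<le> m \<Longrightarrow> \<forall>k<p. nderiv ab k h (tt i) = 0" for i
  proof (induction i)
    case 0
    show ?case
    proof (intro allI impI)
      fix k assume "k < p"
      then show "nderiv ab k h (tt 0) = 0" using h0 by (cases k) (auto simp: interp_bc_def simp del: nderiv.simps(2))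
    qed
  next
    case (Suc i)
    then have "i < m" "\<forall>k<p. nderiv ab k h (tt i) = 0" "tt (Suc i) \<in> I i"
      using mesh by (auto intro: less_imp_le)
    then show ?case using piece by blast
  qed
  obtain i where "i < m" "t \<in> I i" using partition_cover[OF m t] by blast
  then have "nderiv ab 0 h t = 0" using knots[of i] p by (intro piece[of i]) auto
  then show ?thesis by simp
qed

lemma spline_minimal:
  assumes s: "gen_spline p A tt m sd eta0 etam s" and g: "g \<in> Omega p tt m"
    and gbc: "interp_bc p tt m sd eta0 etam g" and ne: "\<exists>t\<in>ab. g t \<noteq> s t"
  shows "Jfun p A (tt 0) (tt m) s < Jfun p A (tt 0) (tt m) g"
proof -
  define h where "h t = g t - s t" for t
  have s\<Omega>: "s \<in> Omega p tt m" using s by (simp add: gen_spline_def)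
  have h: "h \<in> Omega p tt m"
    unfolding Omega_def h_def using OmegaD[OF s\<Omega>] OmegaD[OF g] mesh ab by (auto intro!: C_on_diff)
  have nh: "nderiv ab k h t = nderiv ab k g t - nderiv ab k s t" if "k \<le> 2*p-2" "t \<in> ab" for k t
    unfolding h_def[abs_def] using C_on_diff(2)[OF ab OmegaD(1)[OF g] OmegaD(1)[OF s\<Omega>] that] .
  have sbc: "interp_bc p tt m sd eta0 etam s" using s by (simp add: gen_spline_def)
  have h0: "interp_bc p tt m (\<lambda>_. 0) (\<lambda>_. 0) (\<lambda>_. 0) h"
    unfolding interp_bc_def
  proof (intro conjI allI impI ballI)
    show "h (tt i) = 0" if "i \<le> m" for i using gbc sbc that by (simp add: h_def interp_bc_def)
    fix k assume k: "k \<in> {1..p-1}"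
    then have "k \<le> 2*p-2" by auto
    then show "nderiv ab k h (tt 0) = 0" "nderiv ab k h (tt m) = 0"
      using k gbc sbc ab nh[of k "tt 0"] nh[of k "tt m"] by (simp_all add: interp_bc_def)
  qed
  let ?L = "\<lambda>i. Lop p A (I i)"
  let ?J = "\<lambda>f g. (\<Sum>i<m. integral (I i) (\<lambda>t. ?L i f t \<bullet> ?L i g t))"
  have "integral (I i) (\<lambda>t. ?L i g t \<bullet> ?L i g t) = integral (I i) (\<lambda>t. ?L i s t \<bullet> ?L i s t)
      + 2 * integral (I i) (\<lambda>t. ?L i h t \<bullet> ?L i s t) + integral (I i) (\<lambda>t. ?L i h t \<bullet> ?L i h t)"
    if i: "i < m" for i
  proof -
    have int: "(\<lambda>t. ?L i f t \<bullet> ?L i f' t) integrable_on I i"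
      if "f \<in> Omega p tt m" "f' \<in> Omega p tt m" for f f'
      using continuous_Lop_I i that by (intro integrable_continuous_real continuous_intros) auto
    have "?L i g t = ?L i s t + ?L i h t" if "t \<in> I i" for t
      using Lop_add[OF _ OmegaD(3)[OF s\<Omega> i] OmegaD(3)[OF h i] that, of A] mesh i
      by (simp add: h_def)
    then have "integral (I i) (\<lambda>t. ?L i g t \<bullet> ?L i g t) = integral (I i)
        (\<lambda>t. ?L i s t \<bullet> ?L i s t + 2 * (?L i h t \<bullet> ?L i s t) + ?L i h t \<bullet> ?L i h t)"
      by (intro integral_cong) (simp add: inner_add inner_commute)
    also have "\<dots> = integral (I i) (\<lambda>t. ?L i s t \<bullet> ?L i s t)
      + 2 * integral (I i) (\<lambda>t. ?L i h t \<bullet> ?L i s t) + integral (I i) (\<lambda>t. ?L i h t \<bullet> ?L i h t)"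
      using int[OF s\<Omega> s\<Omega>] int[OF h s\<Omega>] int[OF h h]
      by (simp add: integral_add integrable_add integrable_on_cmult_left)
    finally show ?thesis .
  qed
  then have "?J g g = ?J s s + 2 * ?J h s + ?J h h"
    by (simp add: sum.distrib sum_distrib_left)
  moreover have "?J h s = 0"
    using s by (intro spline_orthogonal s\<Omega> h h0) (simp add: gen_spline_def)
  moreover have "?J h h > 0"
  proof -
    have nn: "0 \<le> integral (I i) (\<lambda>t. ?L i h t \<bullet> ?L i h t)" if "i < m" for i
      using continuous_Lop_I[OF h that]
      by (intro integral_nonneg integrable_continuous_real continuous_intros) auto
    have "?J h h \<noteq> 0"
    proof
      assume "?J h h = 0"
      then have z: "integral (I i) (\<lambda>t. ?L i h t \<bullet> ?L i h t) = 0" if "i < m" for i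
        using that nn by (subst (asm) sum_nonneg_eq_0_iff) auto
      have "?L i h t = 0" if i: "i < m" "t \<in> I i" for i t
      proof -
        \<comment> \<open>A continuous nonnegative function with zero integral over a nondegenerate
          interval vanishes everywhere on it.\<close>
        have "\<forall>t\<in>I i. ?L i h t \<bullet> ?L i h t = 0"
          using continuous_Lop_I[OF h i(1)] mesh i(1) z[OF i(1)]
          by (subst integral_eq_0_iff[symmetric]) (auto intro!: continuous_intros)
        then show ?thesis using i by simp
      qed
      then show False using Lop_zero_imp_zero[OF h h0] ne by (auto simp: h_def)
    qed
    then show ?thesis using sum_nonneg[of "{..<m}", OF nn] by (simp add: less_le)
  qed
  ultimately show ?thesis by (simp add: Jfun_pieces[OF g] Jfun_pieces[OF s\<Omega>])
qed

text \<open>The zero function is a competitor with value 0 of the functional; a spline different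
  from it would have a strictly smaller, hence negative, value.\<close>

lemma spline_zero_data:
  assumes s: "gen_spline p A tt m (\<lambda>_. 0) (\<lambda>_. 0) (\<lambda>_. 0) s" and t: "t \<in> ab"
  shows "s t = 0"
proof (rule ccontr)
  assume "s t \<noteq> 0"
  let ?z = "\<lambda>t::real. 0 :: real^'n"
  have nz: "nderiv ab k ?z t = 0" if "t \<in> ab" for k t
    using nderiv_chain[OF ab, of ?z "\<lambda>_ _. 0" k k t] that by auto
  have "?z \<in> Omega p tt m" using mesh ab by (auto simp: Omega_def intro: C_on_const)
  moreover have "interp_bc p tt m (\<lambda>_. 0) (\<lambda>_. 0) (\<lambda>_. 0) ?z"
    using nz ab by (auto simp: interp_bc_def)
  ultimately have "Jfun p A (tt 0) (tt m) s < Jfun p A (tt 0) (tt m) ?z"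
    using \<open>s t \<noteq> 0\<close> t by (intro spline_minimal[OF s]) auto
  also have "Jfun p A (tt 0) (tt m) ?z = integral ab (\<lambda>t. 0)"
    unfolding Jfun_def by (intro integral_cong) (simp add: Lop_def nz)
  finally have "Jfun p A (tt 0) (tt m) s < 0" by simp
  moreover have "0 \<le> Jfun p A (tt 0) (tt m) s"
    using s continuous_Lop_I unfolding gen_spline_def
    by (subst Jfun_pieces) (auto intro!: sum_nonneg integral_nonneg integrable_continuous_real continuous_intros)
  ultimately show False by simp
qed

end

section \<open>The first-order system\<close>

text \<open>The equation \<open>L\<^sup>* L s = 0\<close> as a first-order system: components \<open>0, \<dots>, p-1\<close> of the state are
  the derivatives of \<open>s\<close>, and components \<open>p, \<dots>, 2p-1\<close> are the quasi-derivatives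
  \<open>1, \<dots>, p\<close> of \<open>L s\<close>. Unlike the expanded operator of order \<open>2p\<close>, it has no derivatives of
  the coefficients.\<close>

definition state_u :: "nat \<Rightarrow> (nat \<Rightarrow> real \<Rightarrow> real^'n) \<Rightarrow> real \<Rightarrow> real^'n" where
  "state_u p X t = (-1)^p *\<^sub>R X (2*p-1) t"

text \<open>The last case is the recursion of the quasi-derivatives, component \<open>k\<close>
  being number \<open>k - p + 1\<close>. For \<open>k = p\<close> the predecessor would be number 0,
  the adjoint itself; putting 0 there is the equation \<open>L* L s = 0\<close>.\<close>

definition state_rhs ::
  "nat \<Rightarrow> (nat \<Rightarrow> real \<Rightarrow> real^'n^'n) \<Rightarrow> (nat \<Rightarrow> real \<Rightarrow> real^'n) \<Rightarrow> nat \<Rightarrow> real \<Rightarrow> real^'n" where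
  "state_rhs p A X k t =
    (if Suc k < p then X (Suc k) t
     else if Suc k = p then state_u p X t + (\<Sum>j<p. A j t *v X j t)
     else (if k = p then 0 else X (k - 1) t)
       + (-1)^(k-p) *\<^sub>R (transpose (A (k-p) t) *v state_u p X t))"

definition state_sol ::
  "nat \<Rightarrow> (nat \<Rightarrow> real \<Rightarrow> real^'n^'n) \<Rightarrow> real set \<Rightarrow> (nat \<Rightarrow> real \<Rightarrow> real^'n) \<Rightarrow> bool" where
  "state_sol p A S X \<longleftrightarrow>
    (\<forall>k<2*p. \<forall>t\<in>S. (X k has_vector_derivative state_rhs p A X k t) (at t within S))"

lemma state_sol_subset: "state_sol p A S X \<Longrightarrow> T \<subseteq> S \<Longrightarrow> state_sol p A T X"
  unfolding state_sol_def using has_vector_derivative_within_subset by blast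

lemma state_sol_zero_fun: "state_sol p A S (\<lambda>k t. 0)"
  by (simp add: state_sol_def state_rhs_def state_u_def)

lemma state_sol_add:
  assumes "state_sol p A S X" "state_sol p A S Y"
  shows "state_sol p A S (\<lambda>k t. X k t + Y k t)"
proof -
  have "state_rhs p A (\<lambda>k t. X k t + Y k t) k t = state_rhs p A X k t + state_rhs p A Y k t" for k t
    by (simp add: state_rhs_def state_u_def matrix_vector_right_distrib sum.distrib scaleR_add_right algebra_simps)
  then show ?thesis using assms by (simp add: state_sol_def has_vector_derivative_add)
qed

lemma state_sol_scaleR:
  assumes "state_sol p A S X"
  shows "state_sol p A S (\<lambda>k t. a *\<^sub>R X k t)"
proof -
  have "state_rhs p A (\<lambda>k t. a *\<^sub>R X k t) k t = a *\<^sub>R state_rhs p A X k t" for k t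
    by (simp add: state_rhs_def state_u_def matrix_vector_mult_scaleR scaleR_sum_right scaleR_add_right
        mult.commute)
  then show ?thesis using assms
    by (simp add: state_sol_def bounded_linear.has_vector_derivative[OF bounded_linear_scaleR_right])
qed

lemma state_sol_exists:
  fixes A :: "nat \<Rightarrow> real \<Rightarrow> real^'n^'n"
  assumes p: "1 \<le> p" and A: "\<And>j. j < p \<Longrightarrow> continuous_on {c..d} (A j)"
  shows "\<exists>X. state_sol p A {c..d} X \<and> (\<forall>k<2*p. X k c = x0 k)"
proof -
  \<comment> \<open>Column \<open>2*p-1\<close> carries \<open>state_u\<close> with its sign.
    Entries are sums of separate contributions so that each can be extracted from the matrix product
    on its own.\<close>
  define M :: "nat \<Rightarrow> nat \<Rightarrow> real \<Rightarrow> real^'n^'n" where "M k j t =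
    (if Suc k < p then (if j = Suc k then mat 1 else 0)
     else if Suc k = p then (if j < p then A j t else 0) + (if j = 2*p-1 then (-1)^p *\<^sub>R mat 1 else 0)
     else (if k \<noteq> p \<and> j = k - 1 then mat 1 else 0)
       + (if j = 2*p-1 then ((-1)^(k-p) * (-1)^p) *\<^sub>R transpose (A (k-p) t) else 0))" for k j t
  have cont: "continuous_on {c..d} (M k j)" if "k < 2*p" for k j
  proof -
    have "continuous_on {c..d} (\<lambda>t. transpose (A (k-p) t))" if "\<not> Suc k < p" "Suc k \<noteq> p"
      using bounded_linear.continuous_on[OF bounded_linear_transpose A] that \<open>k < 2*p\<close> by auto
    note tr = this
    consider "Suc k < p" | "Suc k = p" | "p \<le> k" by linarith
    then show ?thesis
    proof cases
      case 1
      then show ?thesis by (simp add: M_def[abs_def])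
    next
      case 2
      then show ?thesis using A by (cases "j < p"; cases "j = 2*p-1")
        (simp_all add: M_def[abs_def] continuous_on_add)
    next
      case 3
      then show ?thesis using tr by (cases "j = 2*p-1")
        (simp_all add: M_def[abs_def] continuous_on_add continuous_on_scaleR)
    qed
  qed
  have rhs: "(\<Sum>j<2*p. M k j t *v X j t) = state_rhs p A X k t" if k: "k < 2*p"
    for k t and X :: "nat \<Rightarrow> real \<Rightarrow> real^'n"
  proof -
    have pick: "(\<Sum>j<2*p. (if j = l then N else 0) *v X j t) = N *v X l t"
      if "l < 2*p" for l and N :: "real^'n^'n"
    proof -
      have "(\<Sum>j<2*p. (if j = l then N else 0) *v X j t) = (\<Sum>j<2*p. if j = l then N *v X j t else 0)"
        by (intro sum.cong) auto
      then show ?thesis using that by simp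
    qed
    consider "Suc k < p" | "Suc k = p" | "p \<le> k" by linarith
    then show ?thesis
    proof cases
      case 1
      then show ?thesis using pick[of "Suc k" "mat 1"] by (simp add: M_def state_rhs_def)
    next
      case 2
      have "(\<Sum>j<2*p. (if j < p then A j t else 0) *v X j t) = (\<Sum>j<p. A j t *v X j t)"
        by (intro sum.mono_neutral_cong_right) auto
      then show ?thesis using 2 p pick[of "2*p-1" "(-1)^p *\<^sub>R mat 1"]
        by (simp add: M_def state_rhs_def state_u_def matrix_vector_mult_add_rdistrib sum.distrib
            scaleR_matrix_vector_assoc[symmetric])
    next
      case 3
      have "(\<Sum>j<2*p. (if k \<noteq> p \<and> j = k - 1 then mat 1 else 0) *v X j t) = (if k = p then 0 else X (k - 1) t)"
        using pick[of "k - 1" "mat 1"] k 3 by auto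
      then show ?thesis using 3 p pick[of "2*p-1" "((-1)^(k-p) * (-1)^p) *\<^sub>R transpose (A (k-p) t)"]
        by (simp add: M_def state_rhs_def state_u_def matrix_vector_mult_add_rdistrib sum.distrib
            scaleR_matrix_vector_assoc[symmetric] matrix_vector_mult_scaleR)
    qed
  qed
  obtain X where "\<forall>k<2*p. X k c = x0 k \<and> (\<forall>t\<in>{c..d}.
    (X k has_vector_derivative (\<Sum>j<2*p. M k j t *v X j t)) (at t within {c..d}))"
    using linear_system_exists[of "2*p" c d M x0] cont by blast
  then show ?thesis unfolding state_sol_def using rhs by (intro exI[of _ X]) auto
qed

text \<open>Bootstrapping: all components gain smoothness together up to order \<open>r + 1\<close>,
  and each step down the chain from \<open>p - 1\<close> to 0 then adds one more. It is applied with
  \<open>r = p\<close> on a piece and with \<open>r = p - 2\<close> on the whole interval.\<close>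

lemma Lop_chain:
  fixes x :: "nat \<Rightarrow> real \<Rightarrow> real^'n"
  assumes cd: "c < d" and p: "1 \<le> p" and A: "\<And>j. j < p \<Longrightarrow> C_on r {c..d} (A j)"
    and u: "C_on r {c..d} u"
    and x: "\<And>j t. Suc j < p \<Longrightarrow> t \<in> {c..d} \<Longrightarrow> (x j has_vector_derivative x (Suc j) t) (at t within {c..d})"
    and xp: "\<And>t. t \<in> {c..d} \<Longrightarrow>
      (x (p-1) has_vector_derivative u t + (\<Sum>j<p. A j t *v x j t)) (at t within {c..d})"
  shows "C_on (r + p) {c..d} (x 0)"
    and "\<And>j t. j < p \<Longrightarrow> t \<in> {c..d} \<Longrightarrow> nderiv {c..d} j (x 0) t = x j t"
    and "\<And>t. t \<in> {c..d} \<Longrightarrow> Lop p A {c..d} (x 0) t = u t"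
proof -
  have cont: "continuous_on {c..d} (x j)" if "j < p" for j
  proof (cases "Suc j < p")
    case True
    then show ?thesis using x by (intro continuous_on_vector_derivative[of _ _ "x (Suc j)"]) auto
  next
    case False
    then have "j = p - 1" using that by simp
    then show ?thesis using continuous_on_vector_derivative[OF xp] by simp
  qed
  have "q \<le> Suc r \<Longrightarrow> j < p \<Longrightarrow> C_on q {c..d} (x j)" for q j
  proof (induction q arbitrary: j)
    case 0
    then show ?case using cont by (simp add: C_on_0)
  next
    case (Suc q)
    show ?case
    proof (cases "Suc j < p")
      case True
      then show ?thesis using x Suc by (intro C_on_SucI[OF cd, of _ "x (Suc j)"]) auto
    next
      case False
      then have j: "j = p - 1" using Suc by simp
      have "C_on q {c..d} (\<lambda>t. A i t *v x i t)" if "i < p" for i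
        using C_on_mono[OF A[OF that], of q] Suc that by (intro C_on_matrix_vector_mult cd) auto
      then have "C_on q {c..d} (\<lambda>t. u t + (\<Sum>j<p. A j t *v x j t))"
        using C_on_mono[OF u, of q] Suc.prems by (intro C_on_add(1) C_on_sum cd) auto
      then show ?thesis unfolding j using xp by (intro C_on_SucI[OF cd])
    qed
  qed
  then have base: "C_on (Suc r) {c..d} (x (p-1))" using p by simp
  have "i < p \<Longrightarrow> C_on (Suc r + i) {c..d} (x (p-1-i))" for i
  proof (induction i)
    case (Suc i)
    have "Suc (p - 1 - Suc i) = p - 1 - i" using Suc.prems by simp
    then show ?case using Suc x[of "p - 1 - Suc i"] C_on_SucI[OF cd, of "x (p - 1 - Suc i)" "x (p-1-i)" "Suc r + i"]
      by (simp add: Suc_diff_Suc)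
  qed (use base in simp)
  from this[of "p-1"] show "C_on (r + p) {c..d} (x 0)" using p by simp
  define F where "F j = (if j < p then x j else (\<lambda>t. u t + (\<Sum>j<p. A j t *v x j t)))" for j
  have F: "nderiv {c..d} j (x 0) t = F j t" if "j \<le> p" "t \<in> {c..d}" for j t
  proof (rule nderiv_chain[OF cd _ _ that])
    show "x 0 t = F 0 t" for t using p by (simp add: F_def)
    show "(F j has_vector_derivative F (Suc j) t) (at t within {c..d})" if "j < p" "t \<in> {c..d}" for j t
    proof (cases "Suc j < p")
      case False
      then have "j = p - 1" "Suc (p - 1) = p" using that by auto
      then show ?thesis using xp[OF that(2)] that(1) by (simp add: F_def)
    qed (use x that in \<open>auto simp: F_def\<close>)
  qed
  then show "\<And>j t. j < p \<Longrightarrow> t \<in> {c..d} \<Longrightarrow> nderiv {c..d} j (x 0) t = x j t"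
    by (simp add: F_def)
  show "Lop p A {c..d} (x 0) t = u t" if "t \<in> {c..d}" for t
    using F[OF _ that] by (simp add: Lop_def F_def)
qed

lemma nderiv_zero:
  assumes "c < d" "\<And>t. t \<in> {c..d} \<Longrightarrow> f t = 0" "t \<in> {c..d}"
  shows "nderiv {c..d} j f t = 0"
  using nderiv_chain[of c d f "\<lambda>_ _. 0" j j t] assms by auto

lemma Lop_cong:
  assumes "\<And>t. t \<in> S \<Longrightarrow> f t = g t" "t \<in> S"
  shows "Lop p A S f t = Lop p A S g t"
  by (simp add: Lop_def nderiv_cong[OF assms])

lemma Ladj_cong:
  assumes "\<And>t. t \<in> S \<Longrightarrow> f t = g t" "t \<in> S"
  shows "Ladj p A S f t = Ladj p A S g t"
proof -
  have "nderiv S j (\<lambda>\<tau>. transpose (A j \<tau>) *v f \<tau>) t = nderiv S j (\<lambda>\<tau>. transpose (A j \<tau>) *v g \<tau>) t" for j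
    using assms by (intro nderiv_cong) auto
  then show ?thesis by (simp add: Ladj_def nderiv_cong[OF assms])
qed

lemma state_sol_smooth:
  fixes X :: "nat \<Rightarrow> real \<Rightarrow> real^'n"
  assumes cd: "c < d" and p: "1 \<le> p" and A: "\<And>j. j < p \<Longrightarrow> C_on p {c..d} (A j)"
    and X: "state_sol p A {c..d} X"
  shows "C_on (2*p) {c..d} (X 0)"
    and "\<And>j t. j < p \<Longrightarrow> t \<in> {c..d} \<Longrightarrow> nderiv {c..d} j (X 0) t = X j t"
    and "\<And>t. t \<in> {c..d} \<Longrightarrow> Lop p A {c..d} (X 0) t = state_u p X t"
    and "\<And>k t. k \<le> p \<Longrightarrow> t \<in> {c..d} \<Longrightarrow>
      (if k = 0 then 0 else X (p + k - 1) t) = quasi_deriv p A {c..d} (state_u p X) k t"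
    and "\<And>t. t \<in> {c..d} \<Longrightarrow> Ladj p A {c..d} (Lop p A {c..d} (X 0)) t = 0"
proof -
  let ?u = "state_u p X"
  \<comment> \<open>The candidate for quasi-derivative \<open>k\<close> of \<open>L s\<close>, with
    \<open>w 0 = 0\<close> standing for the vanishing adjoint.\<close>
  define w where "w k = (if k = 0 then (\<lambda>t. 0) else X (p + k - 1))" for k
  have w: "(w (Suc k) has_vector_derivative w k t + (-1)^k *\<^sub>R (transpose (A k t) *v ?u t))
      (at t within {c..d})" if "k < p" "t \<in> {c..d}" for k t
    using X that unfolding state_sol_def
    by (auto dest!: spec[of _ "p + k"] simp: state_rhs_def w_def)
  have u: "?u = (\<lambda>t. (-1)^p *\<^sub>R w p t)" using p by (simp add: fun_eq_iff w_def state_u_def mult_2)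
  \<comment> \<open>All \<open>w k\<close> are raised simultaneously, because each derivative
    involves both the predecessor and \<open>state_u\<close>, which is the top member up to
    sign.\<close>
  have "q \<le> p \<Longrightarrow> k \<le> p \<Longrightarrow> C_on q {c..d} (w k)" for q k
  proof (induction q arbitrary: k)
    case 0
    show ?case
    proof (cases k)
      case (Suc k')
      then show ?thesis using w 0 unfolding C_on_0
        by (intro continuous_on_vector_derivative[of _ "w k"]) (auto simp: Suc_le_eq)
    qed (simp add: w_def C_on_0)
  next
    case (Suc q)
    show ?case
    proof (cases k)
      case 0
      then show ?thesis using cd by (simp add: w_def C_on_const)
    next
      case (Suc k')
      have "C_on q {c..d} ?u" unfolding u using Suc.IH[of p] Suc.prems by (intro C_on_scaleR(1) cd) auto
      then have "C_on q {c..d} (\<lambda>t. w k' t + (-1)^k' *\<^sub>R (transpose (A k' t) *v ?u t))"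
        using Suc Suc.prems Suc.IH[of k'] C_on_mono[OF A[of k'], of q]
        by (intro C_on_add(1) C_on_scaleR(1) C_on_transpose_mult cd) auto
      then show ?thesis unfolding Suc using w Suc Suc.prems by (intro C_on_SucI[OF cd]) auto
    qed
  qed
  then have "C_on p {c..d} (w p)" by simp
  then have Cu: "C_on p {c..d} ?u" unfolding u by (intro C_on_scaleR(1) cd)
  have x: "(X j has_vector_derivative X (Suc j) t) (at t within {c..d})" if "Suc j < p" "t \<in> {c..d}" for j t
    using X that unfolding state_sol_def by (auto dest!: spec[of _ j] simp: state_rhs_def)
  have xp: "(X (p-1) has_vector_derivative ?u t + (\<Sum>j<p. A j t *v X j t)) (at t within {c..d})"
    if "t \<in> {c..d}" for t
    using X that p unfolding state_sol_def by (auto dest!: spec[of _ "p-1"] simp: state_rhs_def)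
  note chain = Lop_chain[where x=X and A=A, OF cd p A Cu x xp]
  show "C_on (2*p) {c..d} (X 0)" using chain(1) by (simp add: mult_2)
  show "\<And>j t. j < p \<Longrightarrow> t \<in> {c..d} \<Longrightarrow> nderiv {c..d} j (X 0) t = X j t" using chain(2) .
  show L: "\<And>t. t \<in> {c..d} \<Longrightarrow> Lop p A {c..d} (X 0) t = ?u t" using chain(3) .
  have wq: "w k t = quasi_deriv p A {c..d} ?u k t" if "k \<le> p" "t \<in> {c..d}" for k t
    using that by (intro quasi_deriv_eqI[where w=w and A=A, OF cd A Cu _ w])
      (simp_all add: fun_cong[OF u] power_mult_distrib[symmetric])
  then show "(if k = 0 then 0 else X (p + k - 1) t) = quasi_deriv p A {c..d} ?u k t"
    if "k \<le> p" "t \<in> {c..d}" for k t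
    using that wq[OF that] by (cases "k = 0") (simp_all add: w_def)
  show "Ladj p A {c..d} (Lop p A {c..d} (X 0)) t = 0" if "t \<in> {c..d}" for t
    using Ladj_cong[of "{c..d}" "Lop p A {c..d} (X 0)" ?u t p A] L wq[of 0 t] that
    by (simp add: quasi_deriv_0 w_def)
qed

text \<open>The whole state is recovered from its component 0: the lower half consists of
  derivatives of it, the upper half of quasi-derivatives of its image under
  \<open>L\<close>.\<close>

lemma state_sol_zero:
  fixes X :: "nat \<Rightarrow> real \<Rightarrow> real^'n"
  assumes cd: "c < d" and p: "1 \<le> p" and A: "\<And>j. j < p \<Longrightarrow> C_on p {c..d} (A j)"
    and X: "state_sol p A {c..d} X" and X0: "\<And>t. t \<in> {c..d} \<Longrightarrow> X 0 t = 0"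
    and k: "k < 2*p" and t: "t \<in> {c..d}"
  shows "X k t = 0"
proof (cases "k < p")
  case True
  then show ?thesis
    using state_sol_smooth(2)[OF cd p A X True t] nderiv_zero[of c d "X 0" t k, OF cd X0 t] by simp
next
  case False
  have u: "state_u p X \<tau> = 0" if "\<tau> \<in> {c..d}" for \<tau>
    using state_sol_smooth(3)[where A=A, OF cd p A X that] nderiv_zero[of c d "X 0" \<tau>, OF cd X0 that]
    by (simp add: Lop_def)
  have "quasi_deriv p A {c..d} (state_u p X) (k - p + 1) t = 0"
  proof -
    have "nderiv {c..d} i (state_u p X) t = 0" for i
      using u by (intro nderiv_zero[OF cd _ t]) auto
    moreover have "nderiv {c..d} i (\<lambda>\<tau>. transpose (A j \<tau>) *v state_u p X \<tau>) t = 0" for i j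
      using u by (intro nderiv_zero[OF cd _ t]) auto
    ultimately show ?thesis unfolding quasi_deriv_def by (simp only: scaleR_zero_right sum.neutral_const add_0)
  qed
  then show ?thesis using state_sol_smooth(4)[where A=A, OF cd p A X _ t, of "k - p + 1"] False k by simp
qed

section \<open>Existence of splines\<close>

lemma continuous_on_partition:
  fixes f :: "real \<Rightarrow> 'a::topological_space"
  assumes "\<forall>i<m. tt i < tt (Suc i)"
    and "\<And>i. i < m \<Longrightarrow> continuous_on {tt i..tt (Suc i)} f"
  shows "continuous_on {tt 0..tt m} f"
  using assms
proof (induction m)
  case (Suc m)
  have "tt 0 \<le> tt m" "tt m \<le> tt (Suc m)"
    using Suc.prems(1) by (auto intro: partition_mono[of "Suc m"])
  then have "{tt 0..tt (Suc m)} = {tt 0..tt m} \<union> {tt m..tt (Suc m)}" by auto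
  then show ?case using Suc by (simp add: continuous_on_closed_Un)
qed auto

context spline_problem
begin

text \<open>States are given piece by piece, because component \<open>p\<close> is two-valued at the knots.\<close>

definition spline_state :: "(nat \<Rightarrow> nat \<Rightarrow> real \<Rightarrow> real^'n) \<Rightarrow> bool" where
  "spline_state X \<longleftrightarrow> (\<forall>i<m. state_sol p A (I i) (X i)) \<and>
    (\<forall>i k. Suc i < m \<longrightarrow> k < 2*p \<longrightarrow> k \<noteq> p \<longrightarrow> X i k (tt (Suc i)) = X (Suc i) k (tt (Suc i)))"

text \<open>At an interior knot the choice between the two pieces is arbitrary, which is harmless
  for every component except \<open>p\<close>.\<close>

definition glue :: "(nat \<Rightarrow> nat \<Rightarrow> real \<Rightarrow> real^'n) \<Rightarrow> nat \<Rightarrow> real \<Rightarrow> real^'n" where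
  "glue X k t = X (SOME i. i < m \<and> t \<in> I i) k t"

lemma glue_eq:
  assumes X: "spline_state X" and k: "k < 2*p" "k \<noteq> p" and i: "i < m" "t \<in> I i"
  shows "glue X k t = X i k t"
proof -
  \<comment> \<open>Pieces with indices \<open>i < j\<close> can share a point only if they are
    adjacent, and then it is their common knot.\<close>
  have le: "X i k t = X j k t" if "i < j" "j < m" "t \<in> I i" "t \<in> I j" for i j
  proof -
    have "tt (Suc i) \<le> tt j" using that by (intro partition_mono[OF mesh]) auto
    then have t: "t = tt j" "tt (Suc i) = tt j" using that by auto
    then have "\<not> Suc i < j" using partition_strict_mono[OF mesh, of "Suc i" j] that(2) by force
    then have "j = Suc i" using that(1) by simp
    then have "X i k (tt (Suc i)) = X (Suc i) k (tt (Suc i))"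
      using X k that(2) unfolding spline_state_def by blast
    then show ?thesis unfolding t(1) \<open>j = Suc i\<close> .
  qed
  define j where "j = (SOME i. i < m \<and> t \<in> I i)"
  have "j < m \<and> t \<in> I j" unfolding j_def by (rule someI[of _ i]) (use i in simp)
  then have "X j k t = X i k t" using i le linorder_neqE_nat by metis
  then show ?thesis by (simp add: glue_def j_def)
qed

lemma continuous_glue:
  assumes X: "spline_state X" and k: "k < 2*p" "k \<noteq> p"
  shows "continuous_on ab (glue X k)"
proof (rule continuous_on_partition[OF mesh])
  fix i assume i: "i < m"
  have "continuous_on (I i) (X i k)"
    using X i k(1) unfolding spline_state_def state_sol_def
    by (intro continuous_on_vector_derivative[of _ _ "state_rhs p A (X i) k"]) auto
  then show "continuous_on (I i) (glue X k)"
    by (rule continuous_on_eq) (simp add: glue_eq[OF X k i])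
qed

text \<open>Component \<open>p\<close> may jump, and component \<open>p + 1\<close> has it in its
  derivative. For \<open>p = 1\<close> the jumping component is the one defining
  \<open>state_u\<close>; hence \<open>2 \<le> p\<close>.\<close>

lemma glue_has_vector_derivative:
  assumes X: "spline_state X" and k: "k < 2*p" "k \<noteq> p" "k \<noteq> Suc p" and p2: "2 \<le> p" and t: "t \<in> ab"
  shows "(glue X k has_vector_derivative state_rhs p A (glue X) k t) (at t within ab)"
proof (rule has_vector_derivative_partition[OF mesh m _ t])
  fix i t assume i: "i < m" "t \<in> I i"
  have u: "state_u p (glue X) t = state_u p (X i) t"
    using p2 glue_eq[OF X _ _ i, of "2*p-1"] by (auto simp: state_u_def)
  have "state_rhs p A (glue X) k t = state_rhs p A (X i) k t"
    using k p2 unfolding state_rhs_def u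
    by (auto intro!: sum.cong arg_cong2[where f="(*v)"] glue_eq[OF X _ _ i])
  moreover have "(X i k has_vector_derivative state_rhs p A (X i) k t) (at t within I i)"
    using X i k by (auto simp: spline_state_def state_sol_def)
  ultimately show "(glue X k has_vector_derivative state_rhs p A (glue X) k t) (at t within I i)"
    using has_vector_derivative_transform[of t "I i" "glue X k" "X i k"] i
      glue_eq[OF X k(1,2) i(1)] by auto
qed

text \<open>Smoothness grows with the distance from the jumping component \<open>p\<close>:
  component \<open>p + k\<close> is of class \<open>C^(k-1)\<close>. The top one, which is
  \<open>L s\<close> up to sign, is of class \<open>C^(p-2)\<close>, and \<open>Lop_chain\<close>
  adds \<open>p\<close> orders. For \<open>p = 1\<close> only continuity is claimed.\<close>

lemma glue_smooth:
  assumes X: "spline_state X"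
  shows "C_on (2*p-2) ab (glue X 0)"
    and "\<And>k t. k < p \<Longrightarrow> t \<in> ab \<Longrightarrow> nderiv ab k (glue X 0) t = glue X k t"
proof -
  let ?G = "glue X"
  have "C_on (2*p-2) ab (?G 0) \<and> (\<forall>k<p. \<forall>t\<in>ab. nderiv ab k (?G 0) t = ?G k t)"
  proof (cases "p = 1")
    case True
    then show ?thesis using continuous_glue[OF X, of 0] by (simp add: C_on_0)
  next
    case False
    then have p2: "2 \<le> p" using p by simp
    let ?u = "state_u p ?G"
    have u: "?u = (\<lambda>t. (-1)^p *\<^sub>R ?G (p + (p - 1)) t)"
      using p by (simp add: fun_eq_iff state_u_def mult_2)
    note der = glue_has_vector_derivative[OF X _ _ _ p2]
    have "q \<le> p - 2 \<Longrightarrow> Suc q \<le> k \<Longrightarrow> k < p \<Longrightarrow> C_on q ab (?G (p + k))" for q k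
    proof (induction q arbitrary: k)
      case 0
      then show ?case using continuous_glue[OF X, of "p + k"] by (simp add: C_on_0)
    next
      case (Suc q)
      have "C_on q ab ?u" unfolding u using Suc.IH[of "p - 1"] Suc.prems by (intro C_on_scaleR(1) ab) auto
      then have "C_on q ab (\<lambda>t. ?G (p + (k - 1)) t + (-1)^k *\<^sub>R (transpose (A k t) *v ?u t))"
        using Suc.prems Suc.IH[of "k - 1"] C_on_mono[OF A[of k], of q]
        by (intro C_on_add(1) C_on_scaleR(1) C_on_transpose_mult ab) auto
      moreover have "(?G (p + k) has_vector_derivative
          ?G (p + (k - 1)) t + (-1)^k *\<^sub>R (transpose (A k t) *v ?u t)) (at t within ab)" if "t \<in> ab" for t
        using der[of "p + k" t] that Suc.prems by (simp add: state_rhs_def)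
      ultimately show ?case by (intro C_on_SucI[OF ab])
    qed
    from this[of "p - 2" "p - 1"] have "C_on (p - 2) ab (?G (p + (p - 1)))" using p2 by simp
    then have Cu: "C_on (p - 2) ab ?u" unfolding u by (intro C_on_scaleR(1) ab)
    have CA: "C_on (p - 2) ab (A j)" if "j < p" for j using C_on_mono[OF A[OF that]] by simp
    have x: "(?G j has_vector_derivative ?G (Suc j) t) (at t within ab)" if "Suc j < p" "t \<in> ab" for j t
      using der[of j t] that by (simp add: state_rhs_def)
    have xp: "(?G (p-1) has_vector_derivative ?u t + (\<Sum>j<p. A j t *v ?G j t)) (at t within ab)"
      if "t \<in> ab" for t
      using der[of "p-1" t] that p by (simp add: state_rhs_def)
    have "p - 2 + p = 2*p-2" using p2 by simp
    then show ?thesis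
      using Lop_chain(1,2)[where x="?G" and A=A, OF ab p CA Cu x xp] by auto
  qed
  then show "C_on (2*p-2) ab (glue X 0)"
    and "\<And>k t. k < p \<Longrightarrow> t \<in> ab \<Longrightarrow> nderiv ab k (glue X 0) t = glue X k t" by auto
qed

lemma gen_spline_glue:
  assumes X: "spline_state X"
    and left: "\<And>k. k < p \<Longrightarrow> X 0 k (tt 0) = (if k = 0 then sd 0 else eta0 k)"
    and right: "\<And>k. k < p \<Longrightarrow> X (m-1) k (tt m) = (if k = 0 then sd m else etam k)"
    and interior: "\<And>i. Suc i < m \<Longrightarrow> X i 0 (tt (Suc i)) = sd (Suc i)"
  shows "gen_spline p A tt m sd eta0 etam (glue X 0)"
proof -
  have eq: "glue X k t = X i k t" if "k < p" "i < m" "t \<in> I i" for k i t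
    using that by (intro glue_eq[OF X]) auto
  have X0: "glue X 0 t = X i 0 t" if "i < m" "t \<in> I i" for i t using eq[of 0] that p by auto
  have smooth: "C_on (2*p) (I i) (X i 0)"
    "\<And>t. t \<in> I i \<Longrightarrow> Ladj p A (I i) (Lop p A (I i) (X i 0)) t = 0" if "i < m" for i
  proof -
    have i: "tt i < tt (Suc i)" and Xi: "state_sol p A (I i) (X i)"
      using mesh that X by (auto simp: spline_state_def)
    show "C_on (2*p) (I i) (X i 0)" by (rule state_sol_smooth(1)[OF i p A_I[OF that] Xi])
    show "\<And>t. t \<in> I i \<Longrightarrow> Ladj p A (I i) (Lop p A (I i) (X i 0)) t = 0"
      by (rule state_sol_smooth(5)[OF i p A_I[OF that] Xi])
  qed
  have "C_on (2*p) (I i) (glue X 0)" if "i < m" for i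
    using C_on_cong[OF _ smooth(1)[OF that], of "glue X 0"] X0[OF that] by simp
  then have \<Omega>: "glue X 0 \<in> Omega p tt m"
    unfolding Omega_def using glue_smooth(1)[OF X] by simp
  have LL: "Ladj p A (I i) (Lop p A (I i) (glue X 0)) t = 0" if "i < m" "t \<in> I i" for i t
  proof -
    have "Lop p A (I i) (glue X 0) \<tau> = Lop p A (I i) (X i 0) \<tau>" if "\<tau> \<in> I i" for \<tau>
      using X0[OF \<open>i < m\<close>] that by (rule Lop_cong)
    then have "Ladj p A (I i) (Lop p A (I i) (glue X 0)) t = Ladj p A (I i) (Lop p A (I i) (X i 0)) t"
      using that(2) by (rule Ladj_cong)
    then show ?thesis using smooth(2) that by simp
  qed
  have m1: "m - 1 < m" "Suc (m - 1) = m" using m by auto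
  have at0: "glue X k (tt 0) = X 0 k (tt 0)" if "k < p" for k
    using mesh m that by (intro eq) (auto intro: less_imp_le)
  have atm: "glue X k (tt m) = X (m-1) k (tt m)" if "k < p" for k
    using mesh m1 that by (intro eq) (auto dest!: spec[of _ "m-1"] intro: less_imp_le)
  have "glue X 0 (tt i) = sd i" if im: "i \<le> m" for i
  proof -
    consider "i = 0" | "i = m" | j where "i = Suc j" "Suc j < m"
      using im by (cases i; cases "i = m") auto
    then show ?thesis
    proof cases
      case 3
      then have "tt j < tt (Suc j)" using mesh by simp
      then show ?thesis using 3 X0[of j "tt i"] interior by simp
    qed (use at0[of 0] atm[of 0] left[of 0] right[of 0] p in auto)
  qed
  moreover have "nderiv ab k (glue X 0) (tt 0) = eta0 k \<and> nderiv ab k (glue X 0) (tt m) = etam k"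
    if "k \<in> {1..p-1}" for k
    using that ab glue_smooth(2)[OF X, of k] at0[of k] atm[of k] left[of k] right[of k] by auto
  ultimately have "interp_bc p tt m sd eta0 etam (glue X 0)" by (simp add: interp_bc_def)
  then show ?thesis using \<Omega> LL by (simp add: gen_spline_def)
qed

section \<open>Finite-dimensional parametrisation of the piecewise states\<close>

lemma spline_state_add:
  "spline_state X \<Longrightarrow> spline_state Y \<Longrightarrow> spline_state (\<lambda>i k t. X i k t + Y i k t)"
  by (simp add: spline_state_def state_sol_add)

lemma spline_state_sum:
  assumes "\<And>q. q \<in> Q \<Longrightarrow> spline_state (B q)"
  shows "spline_state (\<lambda>i k t. \<Sum>q\<in>Q. \<alpha> q *\<^sub>R B q i k t)"
  using assms
proof (induction Q rule: infinite_finite_induct)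
  case (insert q Q)
  have "spline_state (\<lambda>i k t. \<alpha> q *\<^sub>R B q i k t)"
    using insert.prems by (simp add: spline_state_def state_sol_scaleR)
  then show ?case using insert by (simp add: spline_state_add)
qed (simp_all add: spline_state_def state_sol_zero_fun)

text \<open>A response to an impulse at knot \<open>j\<close>: zero to the left, and to the right
  the solution started with \<open>v\<close>. For \<open>j \<noteq> 0\<close> the impulse is
  confined to component \<open>p\<close>, the only one allowed to jump; for \<open>j = 0\<close> it
  is a full initial value.\<close>

lemma spline_state_source:
  assumes j: "j < m" and v: "j \<noteq> 0 \<Longrightarrow> \<forall>k. k \<noteq> p \<longrightarrow> v k = 0"
  shows "\<exists>X. spline_state X \<and> (\<forall>k<2*p. X 0 k (tt 0) = (if j = 0 then v k else 0)) \<and>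
    (\<forall>i. Suc i < m \<longrightarrow>
      X (Suc i) p (tt (Suc i)) - X i p (tt (Suc i)) = (if j = Suc i then v p else 0))"
proof -
  have "continuous_on {tt j..tt m} (A k)" if "k < p" for k
    using C_on_continuous_nderiv[OF A[OF that], of 0] partition_mono[OF mesh, of 0 j] j
    by (auto elim: continuous_on_subset)
  then obtain Y where Y: "state_sol p A {tt j..tt m} Y" "\<And>k. k < 2*p \<Longrightarrow> Y k (tt j) = v k"
    using state_sol_exists[OF p, of "tt j" "tt m" A v] by blast
  define X where "X i k t = (if i < j then 0 else Y k t)" for i k t
  have "state_sol p A (I i) (X i)" if "i < m" for i
  proof (cases "i < j")
    case True
    then show ?thesis by (simp add: X_def[abs_def] state_sol_zero_fun)
  next
    case False
    then have "tt j \<le> tt i" "tt (Suc i) \<le> tt m" using that by (auto intro: partition_mono[OF mesh])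
    then have "state_sol p A (I i) Y" by (intro state_sol_subset[OF Y(1)]) auto
    then show ?thesis using False by (simp add: X_def[abs_def])
  qed
  moreover have "X i k (tt (Suc i)) = X (Suc i) k (tt (Suc i))" if "k < 2*p" "k \<noteq> p" for i k
    using Y(2)[OF that(1)] v that by (cases "j = Suc i") (auto simp: X_def)
  moreover have "X 0 k (tt 0) = (if j = 0 then v k else 0)" if "k < 2*p" for k
    using Y(2)[OF that] by (auto simp: X_def)
  moreover have "X (Suc i) p (tt (Suc i)) - X i p (tt (Suc i)) = (if j = Suc i then v p else 0)" for i
    using Y(2)[of p] p by (auto simp: X_def)
  ultimately show ?thesis by (intro exI[of _ X]) (simp add: spline_state_def)
qed

text \<open>The \<open>p + (m-1)\<close> vector parameters of a state that starts with vanishing derivatives of \<open>s\<close>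
  (initial quasi-derivatives, and jumps of component \<open>p\<close> at the interior knots), and the equally
  many data still to be matched.\<close>

definition param :: "(nat \<Rightarrow> nat \<Rightarrow> real \<Rightarrow> real^'n) \<Rightarrow> nat \<Rightarrow> real^'n" where
  "param X r = (if r < p then X 0 (p + r) (tt 0)
     else X (Suc (r-p)) p (tt (Suc (r-p))) - X (r-p) p (tt (Suc (r-p))))"

definition obs :: "(nat \<Rightarrow> nat \<Rightarrow> real \<Rightarrow> real^'n) \<Rightarrow> nat \<Rightarrow> real^'n" where
  "obs X r = (if r < p then X (m-1) r (tt m) else X (r-p) 0 (tt (Suc (r-p))))"

lemma spline_state_basis:
  assumes r: "r < p + (m - 1)"
  shows "\<exists>X. spline_state X \<and> (\<forall>k<p. X 0 k (tt 0) = 0) \<and>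
    (\<forall>r'<p + (m - 1). param X r' = (if r' = r then v else 0))"
proof -
  \<comment> \<open>Parameter \<open>r < p\<close> is excited by the initial value of component
    \<open>p + r\<close>, a later one by the jump at knot \<open>r - p + 1\<close>.\<close>
  define j where "j = (if r < p then 0 else Suc (r - p))"
  define x where "x k = (if k = (if r < p then p + r else p) then v else 0)" for k
  have "j < m" using r m by (auto simp: j_def)
  moreover have "\<forall>k. k \<noteq> p \<longrightarrow> x k = 0" if "j \<noteq> 0" using that by (auto simp: x_def j_def)
  ultimately obtain X where X: "spline_state X" "\<And>k. k < 2*p \<Longrightarrow> X 0 k (tt 0) = (if j = 0 then x k else 0)"
    "\<And>i. Suc i < m \<Longrightarrow> X (Suc i) p (tt (Suc i)) - X i p (tt (Suc i)) = (if j = Suc i then x p else 0)"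
    using spline_state_source[of j x] by blast
  have "param X r' = (if r' = r then v else 0)" if "r' < p + (m - 1)" for r'
  proof (cases "r' < p")
    case True
    then show ?thesis using X(2)[of "p + r'"] by (auto simp: param_def j_def x_def)
  next
    case False
    then have "Suc (r' - p) < m" using that by simp
    then show ?thesis using X(3)[of "r' - p"] False by (auto simp: param_def j_def x_def)
  qed
  moreover have "X 0 k (tt 0) = 0" if "k < p" for k
    using X(2)[of k] that by (auto simp: x_def)
  ultimately show ?thesis using X(1) by blast
qed

text \<open>The trivial kernel. Zero observations make the glued function a spline with zero data,
  hence zero; then every component vanishes on every closed piece, including both one-sided values
  of component \<open>p\<close>, so initial values and jumps vanish.\<close>

lemma spline_state_obs_zero:
  assumes X: "spline_state X" and left: "\<And>k. k < p \<Longrightarrow> X 0 k (tt 0) = 0"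
    and obs: "\<And>r. r < p + (m - 1) \<Longrightarrow> obs X r = 0" and r: "r < p + (m - 1)"
  shows "param X r = 0"
proof -
  have right: "X (m-1) k (tt m) = 0" if "k < p" for k
    using obs[of k] that by (simp add: obs_def)
  have interior: "X i 0 (tt (Suc i)) = 0" if "Suc i < m" for i
    using obs[of "p + i"] that by (simp add: obs_def)
  have "gen_spline p A tt m (\<lambda>_. 0) (\<lambda>_. 0) (\<lambda>_. 0) (glue X 0)"
    using left right interior by (intro gen_spline_glue[OF X]) auto
  from spline_zero_data[OF this] have "glue X 0 t = 0" if "t \<in> ab" for t using that .
  then have X0: "X i 0 t = 0" if "i < m" "t \<in> I i" for i t
    using glue_eq[OF X _ _ that, of 0] that I_subset[of i] p by auto
  have zero: "X i k t = 0" if "i < m" "k < 2*p" "t \<in> I i" for i k t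
  proof -
    have "tt i < tt (Suc i)" "state_sol p A (I i) (X i)"
      using mesh X that(1) by (auto simp: spline_state_def)
    from state_sol_zero[where A=A, OF this(1) p A_I[OF that(1)] this(2) X0[OF that(1)] that(2,3)]
    show ?thesis .
  qed
  show ?thesis
  proof (cases "r < p")
    case True
    then show ?thesis using zero[of 0 "p + r" "tt 0"] m mesh by (auto simp: param_def intro: less_imp_le)
  next
    case False
    then have i: "Suc (r - p) < m" using r by simp
    then have "tt (Suc (r-p)) \<in> I (r-p)" "tt (Suc (r-p)) \<in> I (Suc (r-p))"
      using mesh by (auto intro: less_imp_le)
    then show ?thesis using zero i p False by (simp add: param_def)
  qed
qed

lemma spline_exists: "\<exists>s. gen_spline p A tt m sd eta0 etam s"
proof -
  \<comment> \<open>Pairs of a vector parameter and a coordinate; the same set indexes the scalar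
    unknowns and the scalar equations, so the system is square.\<close>
  define Q where "Q = {..<p + (m - 1)} \<times> (UNIV :: 'n set)"
  have finQ: "finite Q" by (simp add: Q_def)
  have "\<exists>X. spline_state X \<and> (\<forall>k<p. X 0 k (tt 0) = 0) \<and>
    (\<forall>r'<p + (m - 1). param X r' = (if r' = fst q then axis (snd q) 1 else 0))" if "q \<in> Q" for q
    using that by (intro spline_state_basis) (auto simp: Q_def)
  then obtain B where B: "\<And>q. q \<in> Q \<Longrightarrow> spline_state (B q)"
    "\<And>q k. q \<in> Q \<Longrightarrow> k < p \<Longrightarrow> B q 0 k (tt 0) = 0"
    "\<And>q r. q \<in> Q \<Longrightarrow> r < p + (m - 1) \<Longrightarrow> param (B q) r = (if r = fst q then axis (snd q) 1 else 0)"
    by metis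
  define C where "C \<alpha> i k t = (\<Sum>q\<in>Q. \<alpha> q *\<^sub>R B q i k t)" for \<alpha> i k t
  have C: "spline_state (C \<alpha>)" for \<alpha> unfolding C_def[abs_def] using B(1) by (intro spline_state_sum)
  have C0: "C \<alpha> 0 k (tt 0) = 0" if "k < p" for \<alpha> k using B(2) that by (simp add: C_def)
  have obsC: "obs (C \<alpha>) r $ e = (\<Sum>q\<in>Q. (obs (B q) r $ e) * \<alpha> q)" for \<alpha> r e
    by (simp add: obs_def C_def mult.commute)
  have paramC: "param (C \<alpha>) r $ e = \<alpha> (r, e)" if "(r, e) \<in> Q" for \<alpha> r e
  proof -
    have "param (C \<alpha>) r = (\<Sum>q\<in>Q. \<alpha> q *\<^sub>R param (B q) r)"
      by (simp add: param_def C_def scaleR_diff_right sum_subtractf)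
    also have "\<dots> $ e = (\<Sum>q\<in>Q. if q = (r, e) then \<alpha> q else 0)"
      unfolding sum_component using that B(3) by (intro sum.cong) (auto simp: Q_def axis_def)
    finally show ?thesis using that finQ by simp
  qed
  have ker: "\<forall>q\<in>Q. \<alpha> q = 0"
    if "\<And>i. i \<in> Q \<Longrightarrow> (\<Sum>q\<in>Q. (obs (B q) (fst i) $ snd i) * \<alpha> q) = 0" for \<alpha>
  proof -
    have "obs (C \<alpha>) r = 0" if "r < p + (m - 1)" for r
      using obsC[of \<alpha> r] \<open>\<And>i. i \<in> Q \<Longrightarrow> _ i = 0\<close>[of "(r, _)"] that by (simp add: vec_eq_iff Q_def)
    then have "param (C \<alpha>) r = 0" if "r < p + (m - 1)" for r
      using spline_state_obs_zero[OF C C0] that by blast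
    then show ?thesis using paramC[of _ _ \<alpha>] by (auto simp: Q_def)
  qed
  \<comment> \<open>A particular state with the prescribed left data. Its components from
    \<open>p\<close> on start with whatever \<open>eta0\<close> returns there; the correction by
    \<open>C\<close> absorbs this choice.\<close>
  obtain P where P: "spline_state P" "\<And>k. k < p \<Longrightarrow> P 0 k (tt 0) = (if k = 0 then sd 0 else eta0 k)"
    using spline_state_source[of 0 "\<lambda>k. if k = 0 then sd 0 else eta0 k"] m by auto
  define data where
    "data r = (if r < p then if r = 0 then sd m else etam r else sd (Suc (r - p)))" for r
  obtain \<alpha> where "\<And>i. i \<in> Q \<Longrightarrow>
      (\<Sum>q\<in>Q. (obs (B q) (fst i) $ snd i) * \<alpha> q) = (data (fst i) - obs P (fst i)) $ snd i"
    by (rule square_system_solvable[where A="\<lambda>i q. obs (B q) (fst i) $ snd i"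
          and r="\<lambda>i. (data (fst i) - obs P (fst i)) $ snd i", OF finQ ker]) blast+
  then have obs: "obs (C \<alpha>) r = data r - obs P r" if "r < p + (m - 1)" for r
    unfolding vec_eq_iff obsC using that by (auto simp: Q_def)
  define X where "X i k t = P i k t + C \<alpha> i k t" for i k t
  have obsX: "obs X r = data r" if "r < p + (m - 1)" for r
    using obs[OF that] by (auto simp: obs_def X_def algebra_simps split: if_splits)
  have "spline_state X" unfolding X_def[abs_def] by (rule spline_state_add[OF P(1) C])
  moreover have "X 0 k (tt 0) = (if k = 0 then sd 0 else eta0 k)" if "k < p" for k
    using P(2) C0 that by (simp add: X_def)
  moreover have "X (m-1) k (tt m) = (if k = 0 then sd m else etam k)" if "k < p" for k
    using obsX[of k] that by (simp add: obs_def data_def)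
  moreover have "X i 0 (tt (Suc i)) = sd (Suc i)" if "Suc i < m" for i
    using obsX[of "p + i"] that by (simp add: obs_def data_def)
  ultimately show ?thesis by (intro exI[of _ "glue X 0"] gen_spline_glue)
qed

end

theorem theorem3p11:
  fixes p m :: nat and a b :: real and tt :: "nat \<Rightarrow> real"
    and A :: "nat \<Rightarrow> real \<Rightarrow> real^'n^'n"
    and sd eta0 etam :: "nat \<Rightarrow> real^'n"
  assumes "p \<ge> 1"
    and "\<forall>j<p. C_on p {a..b} (A j)"
    and "m \<ge> 1" and "tt 0 = a" and "tt m = b"
    and "\<forall>i<m. tt i < tt (Suc i)"
  shows "\<exists>s. gen_spline p A tt m sd eta0 etam s
           \<and> (\<forall>s'. gen_spline p A tt m sd eta0 etam s' \<longrightarrow> (\<forall>t\<in>{a..b}. s' t = s t))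
           \<and> (\<forall>g\<in>Omega p tt m. interp_bc p tt m sd eta0 etam g \<and> (\<exists>t\<in>{a..b}. g t \<noteq> s t)
                 \<longrightarrow> Jfun p A a b s < Jfun p A a b g)"
proof -
  interpret spline_problem p m tt A
    using assms by unfold_locales auto
  obtain s where s: "gen_spline p A tt m sd eta0 etam s" using spline_exists by blast
  have min: "Jfun p A a b s < Jfun p A a b g"
    if "gen_spline p A tt m sd eta0 etam s" "g \<in> Omega p tt m" "interp_bc p tt m sd eta0 etam g"
      "\<exists>t\<in>{a..b}. g t \<noteq> s t" for s g
    using spline_minimal[of sd eta0 etam s g] that assms(4,5) by simp
  \<comment> \<open>Two distinct splines compete with each other, so each would have a strictly
    smaller value than the other.\<close>
  have "s' t = s t" if s': "gen_spline p A tt m sd eta0 etam s'" and "t \<in> {a..b}" for s' t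
  proof (rule ccontr)
    assume "s' t \<noteq> s t"
    then have "\<exists>t\<in>{a..b}. s' t \<noteq> s t" "\<exists>t\<in>{a..b}. s t \<noteq> s' t" using that by (auto intro: bexI[of _ t])
    then have "Jfun p A a b s < Jfun p A a b s'" "Jfun p A a b s' < Jfun p A a b s"
      using min[OF s, of s'] min[OF s', of s] s s' unfolding gen_spline_def by auto
    then show False by simp
  qed
  with s min[OF s] show ?thesis by blast
qed

end
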